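(* Fix a universal constant $C>0$, a sequence of positive integers $(D_n)_{n\in\mathbb N}$ with $D_n\le n^{C}$, and a sequence of positive reals $(A_n)_{n\in\mathbb N}$. Consider a Gaussian additive model with discrete prior $P_0=P_0^{(n)}$ on $\mathbb R^n$; let $X,X'$ be i.i.d. from $P_0$, let $\mathbb P(\langle X,X'\rangle=t)$ denote the probability mass function of the overlap and $\mathcal S_{\mathrm{ov}}=\{q\in\mathbb R:\mathbb P(\langle X,X'\rangle=q)>0\}$. Let $a_n:\mathcal S_{\mathrm{ov}}\to\mathbb R_{>0}$, $n\in\mathbb N$, be functions such that $q+a_n(q)\in\mathcal S_{\mathrm{ov}}$ for all $q\in\mathcal S_{\mathrm{ov}}$. Assume: (1) for every multi-index $\alpha\in\mathbb Z_{\ge 0}^n$ with $|\alpha|\le D_n$, the joint cumulant satisfies $\kappa_\alpha(X_1,\dots,X_n)\ge 0$; (2) there exists a universal constant $\phi>0$ such that for all $i\in[n]$ the marginal $X_i$ is sub-Weibull of order $\phi$; (3) there exists a universal constant $C_1>0$ such that for all $n$, $q(D_n(\log n)^2)\ge \max\{(\log n)^{-D_n/2},\,n^{-C_1}\}$; (4) $\displaystyle \mathbf\Delta_{a_n}\log \mathbb P(\langle X,X'\rangle=t)\Big|_{t=q(D_n)}\ \ge\ -\frac{A_n}{q(D_n(\log n)^2)\,\log n}$. For each $n$ let $D_n'$ be a positive integer, with $D_n'=(1+o(1))D_n\log^2 n$. Then for any $u>0$ satisfying $u+\mathbf\Delta_{a_n}\mathcal F_{\mathrm{ann},u}\big|_{q=q(D_n)}>0$,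 $$\mathrm{Corr}^{\le D_n}_{P_0}\!\left(\frac1{A_n}\Big(u+\mathbf\Delta_{a_n}\mathcal F_{\mathrm{ann},u}\Big|_{q=q(D_n)}\Big)\right)^2\le 2\,q(D_n').$$ In particular, for any SNR $\lambda=\lambda_n>0$, if $n$ is large enough, $\mathbf\Delta_{a_n}\mathcal F_{\mathrm{ann},\lambda}\big|_{q=q(D_n)}\ge 0$ implies $\mathrm{Corr}^{\le D_n}_{P_0}\big(\tfrac1{A_n}\lambda\big)^2\le 2q(D_n')$.
   Context: Gaussian additive model (GAM) with prior $P_0$ on $\mathbb R^n$ and signal-to-noise ratio (SNR) $\lambda>0$: one observes $Y=\sqrt\lambda X+Z$ with $X\sim P_0$ and independent $Z\sim N(0,I_n)$. Low-degree correlation: $\mathbb R[Y]_{\le D}$ is the space of polynomials in $Y$ of total degree at most $D$, and $$\mathrm{Corr}^{\le D}_{P_0}(\lambda):=\sqrt{\sum_{i=1}^n\ \sup_{g_i\in\mathbb R[Y]_{\le D},\ \mathbb E[g_i(Y)^2]=1}\mathbb E[g_i(Y)X_i]^2}.$$ Overlap quantile: for $D>0$, $q(D):=\inf\{y\in\mathbb R:\ \mathbb P(|\langle X,X'\rangle|\le y)\ge 1-e^{-D}\}$. Annealed Franz–Parisi (FP) potential (discrete case): for $q\in\mathcal S_{\mathrm{ov}}$, $\mathcal F_{\mathrm{ann},\lambda}(q):=-\log\mathbb E_{X,X'}\big[1_{\langle X,X'\rangle=q}\,e^{\lambda\langle X,X'\rangle}\big]=-\lambda q-\log\mathbb P(\langle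 X,X'\rangle=q)$. Discrete derivative: for $f:\mathcal S_{\mathrm{ov}}\to\mathbb R$ and $q\in\mathcal S_{\mathrm{ov}}$, $\mathbf\Delta_{a_n}(f)(q)=\dfrac{f(q+a_n(q))-f(q)}{a_n(q)}$. Joint cumulant: for a multi-index $\alpha$, $|\alpha|=\sum_i\alpha_i$, and $\kappa_\alpha(X_1,\dots,X_n)$ is the joint cumulant of the collection containing $\alpha_i$ copies of $X_i$ for each $i$ (equal to $0$ for $\alpha=0$). Sub-Weibull: a real random variable $X$ is sub-Weibull of order $\phi>0$ if there exist constants $K>0$, $C_\phi\in(0,\infty)$ with $(\mathbb E|X|^p)^{1/p}\le C_\phi K p^{1/\phi}$ for all $p\ge1$.
   Formalization: D'_n is also required to satisfy D'_n ≥ D_n log² n for all large n (the claim fails otherwise); the first bound is for all large n, uniformly in u; the sub-Weibull constants do not depend on n or i; and q(D_n) is assumed to lie in S_ov for n ≥ 2. *)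

theory Defs
  imports "HOL-Probability.Probability" "HOL-Library.Landau_Symbols"
begin

text \<open>
  Points of \<open>\<real>\<^sup>n\<close> are functions \<open>nat \<Rightarrow> real\<close> of which only the coordinates \<open>i < n\<close>
  matter (coordinates are numbered from \<open>0\<close>). This allows the dimension
  to vary with \<open>n\<close>. A discrete probability distribution is a \<^typ>\<open>'a pmf\<close>; its support is
  countable but may be infinite.
\<close>

definition prior_on :: "nat \<Rightarrow> (nat \<Rightarrow> real) pmf \<Rightarrow> bool" where
  "prior_on n P \<longleftrightarrow> set_pmf P \<subseteq> {..<n} \<rightarrow>\<^sub>E UNIV"

subsection \<open>Gaussian additive model and low-degree correlation\<close>

text \<open>Joint law of the signal \<open>X\<close> and the independent noise \<open>Z\<close>.\<close>

definition gam :: "nat \<Rightarrow> (nat \<Rightarrow> real) pmf \<Rightarrow> ((nat \<Rightarrow> real) \<times> (nat \<Rightarrow> real)) measure" where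
  "gam n P = measure_pmf P \<Otimes>\<^sub>M (\<Pi>\<^sub>M i\<in>{..<n}. density lborel std_normal_density)"

definition observation :: "real \<Rightarrow> (nat \<Rightarrow> real) \<times> (nat \<Rightarrow> real) \<Rightarrow> nat \<Rightarrow> real" where
  "observation snr = (\<lambda>(x, z) i. sqrt snr * x i + z i)"

definition multi_indices :: "nat \<Rightarrow> nat \<Rightarrow> (nat \<Rightarrow> nat) set" where
  "multi_indices n D = {\<alpha>. (\<forall>i\<ge>n. \<alpha> i = 0) \<and> (\<Sum>i<n. \<alpha> i) \<le> D}"

lemma finite_multi_indices: "finite (multi_indices n D)"
proof -
  have "\<alpha> i \<le> D" if "\<alpha> \<in> multi_indices n D" "i < n" for \<alpha> i
    using that member_le_sum[of i "{..<n}" \<alpha>] by (auto simp: multi_indices_def)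
  then have "multi_indices n D \<subseteq>
      {\<alpha>. \<forall>i. (i \<in> {..<n} \<longrightarrow> \<alpha> i \<in> {..D}) \<and> (i \<notin> {..<n} \<longrightarrow> \<alpha> i = 0)}"
    by (auto simp: multi_indices_def)
  then show ?thesis
    by (rule finite_subset) (rule finite_set_of_finite_funs; simp)
qed

definition polys_le :: "nat \<Rightarrow> nat \<Rightarrow> ((nat \<Rightarrow> real) \<Rightarrow> real) set" where
  "polys_le n D =
     range (\<lambda>(c :: (nat \<Rightarrow> nat) \<Rightarrow> real) y. \<Sum>\<alpha>\<in>multi_indices n D. c \<alpha> * (\<Prod>i<n. y i ^ \<alpha> i))"

text \<open>
  The normalisation \<open>E[g(Y)\<^sup>2] = 1\<close> forces \<open>g(Y)\<close> to be square-integrable, since the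
  Bochner integral of a non-integrable function is \<open>0\<close>. When the coordinates of \<open>X\<close> have
  finite second moments, each supremum is over a nonempty set bounded by \<open>E[X\<^sub>i\<^sup>2]\<close>.
\<close>

definition Corr_le :: "nat \<Rightarrow> (nat \<Rightarrow> real) pmf \<Rightarrow> nat \<Rightarrow> real \<Rightarrow> real" where
  "Corr_le n P D snr =
     sqrt (\<Sum>i<n. SUP g \<in> {g \<in> polys_le n D. (\<integral>\<omega>. (g (observation snr \<omega>))\<^sup>2 \<partial>gam n P) = 1}.
                    (\<integral>\<omega>. g (observation snr \<omega>) * fst \<omega> i \<partial>gam n P)\<^sup>2)"

subsection \<open>Overlap of two independent draws, and the Franz--Parisi potential\<close>

definition overlap :: "nat \<Rightarrow> (nat \<Rightarrow> real) \<Rightarrow> (nat \<Rightarrow> real) \<Rightarrow> real" where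
  "overlap n x y = (\<Sum>i<n. x i * y i)"

definition overlap_pmf :: "nat \<Rightarrow> (nat \<Rightarrow> real) pmf \<Rightarrow> real pmf" where
  "overlap_pmf n P = map_pmf (\<lambda>(x, x'). overlap n x x') (pair_pmf P P)"

definition S_ov :: "nat \<Rightarrow> (nat \<Rightarrow> real) pmf \<Rightarrow> real set" where
  "S_ov n P = {q. pmf (overlap_pmf n P) q > 0}"

text \<open>Meaningful for \<open>D > 0\<close> only: otherwise the set is not bounded below.\<close>

definition overlap_quantile :: "nat \<Rightarrow> (nat \<Rightarrow> real) pmf \<Rightarrow> real \<Rightarrow> real" where
  "overlap_quantile n P D =
     Inf {y. measure_pmf.prob (overlap_pmf n P) {t. \<bar>t\<bar> \<le> y} \<ge> 1 - exp (- D)}"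

definition FP_ann :: "nat \<Rightarrow> (nat \<Rightarrow> real) pmf \<Rightarrow> real \<Rightarrow> real \<Rightarrow> real" where
  "FP_ann n P snr q =
     - ln (measure_pmf.expectation (pair_pmf P P)
             (\<lambda>(x, x'). of_bool (overlap n x x' = q) * exp (snr * overlap n x x')))"

lemma FP_ann_eq:
  assumes "q \<in> S_ov n P"
  shows "FP_ann n P snr q = - snr * q - ln (pmf (overlap_pmf n P) q)"
proof -
  have "measure_pmf.expectation (pair_pmf P P)
          (\<lambda>(x, x'). of_bool (overlap n x x' = q) * exp (snr * overlap n x x'))
      = measure_pmf.expectation (overlap_pmf n P) (\<lambda>t. indicator {q} t * exp (snr * q))"
    unfolding overlap_pmf_def integral_map_pmf
    by (rule Bochner_Integration.integral_cong) (auto simp: indicator_def)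
  also have "\<dots> = pmf (overlap_pmf n P) q * exp (snr * q)"
    by (simp add: measure_pmf_single)
  finally show ?thesis
    using assms by (simp add: FP_ann_def S_ov_def ln_mult)
qed

text \<open>Used only at points \<open>q\<close> such that \<open>f\<close> is meaningful at \<open>q\<close> and at \<open>q + a q\<close>.\<close>

definition discrete_deriv :: "(real \<Rightarrow> real) \<Rightarrow> (real \<Rightarrow> real) \<Rightarrow> real \<Rightarrow> real" where
  "discrete_deriv a f q = (f (q + a q) - f q) / a q"

subsection \<open>Joint cumulants and sub-Weibull variables\<close>

text \<open>
  The moment--partition formula for the joint cumulant of a finite family \<open>(Y\<^sub>j)\<close>, \<open>j \<in> J\<close>.
  It only needs finite moments, unlike a definition by derivatives of the cumulant
  generating function. The empty family has cumulant \<open>0\<close> by convention.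
\<close>

definition joint_cumulant :: "'w measure \<Rightarrow> 'j set \<Rightarrow> ('j \<Rightarrow> 'w \<Rightarrow> real) \<Rightarrow> real" where
  "joint_cumulant M J Y =
     (if J = {} then 0
      else \<Sum>\<pi> | partition_on J \<pi>.
             (-1) ^ (card \<pi> - 1) * fact (card \<pi> - 1) * (\<Prod>B\<in>\<pi>. \<integral>\<omega>. (\<Prod>j\<in>B. Y j \<omega>) \<partial>M))"

text \<open>The index \<open>(i, k)\<close> with \<open>k < \<alpha> i\<close> stands for the \<open>k\<close>-th copy of \<open>X\<^sub>i\<close>.\<close>

definition cumulant :: "nat \<Rightarrow> (nat \<Rightarrow> real) pmf \<Rightarrow> (nat \<Rightarrow> nat) \<Rightarrow> real" where
  "cumulant n P \<alpha> =
     joint_cumulant (measure_pmf P) (SIGMA i:{..<n}. {..<\<alpha> i}) (\<lambda>(i, k) x. x i)"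

text \<open>
  \<open>X\<close> is sub-Weibull of order \<open>\<phi>\<close> with the given constants \<open>K\<close> and \<open>C\<^sub>\<phi>\<close>. The constants are
  arguments so that uniformity in a family of variables can be expressed.
\<close>

definition sub_weibull :: "'w measure \<Rightarrow> ('w \<Rightarrow> real) \<Rightarrow> real \<Rightarrow> real \<Rightarrow> real \<Rightarrow> bool" where
  "sub_weibull M X \<phi> K C\<^sub>\<phi> \<longleftrightarrow>
     X \<in> borel_measurable M \<and>
     (\<forall>p\<ge>1. integrable M (\<lambda>\<omega>. \<bar>X \<omega>\<bar> powr p) \<and>
            (\<integral>\<omega>. \<bar>X \<omega>\<bar> powr p \<partial>M) powr (1 / p) \<le> C\<^sub>\<phi> * K * p powr (1 / \<phi>))"

end

theory Submission
  imports Defs "HOL-Computational_Algebra.Polynomial"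
begin

text \<open>
  Since \<open>u + \<Delta>F\<^sub>a\<^sub>n\<^sub>n = - \<Delta> log P\<close> does not depend on \<open>u\<close>, both claims say that
  \<open>Corr\<^sup>2 \<le> 2 q\<close> for every signal-to-noise ratio \<open>\<lambda> \<le> 1 / (q log n)\<close>, where \<open>q\<close> is the overlap quantile at
  \<open>D (log n)\<^sup>2\<close>.

  For a polynomial \<open>g\<close> of degree at most \<open>D\<close>, \<open>E[g(Y) X\<^sub>i] = E[g(Y) W\<^sub>i(Z)]\<close>, where \<open>W\<^sub>i\<close> is the combination
  of Hermite polynomials whose coefficients are the cumulants of \<open>X\<^sub>i\<close> and \<open>\<alpha>\<close> copies of \<open>X\<close>, times
  \<open>\<lambda>\<close> to the power \<open>|\<alpha>| / 2\<close>, divided by \<open>\<alpha>!\<close>; this is the recursion between moments and cumulants.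
  By Cauchy--Schwarz, \<open>Corr\<^sup>2\<close> is at most the sum of the \<open>E[W\<^sub>i\<^sup>2]\<close>. Nonnegativity bounds cumulants by
  moments, and the sums of squared moments are moments of the overlap by the multinomial theorem.

  The quantile together with the sub-Weibull tails gives
  \<open>E[overlap ^ k] \<le> (1 + 1/n) q ^ k\<close> for all \<open>k \<le> D + 1\<close>, so \<open>Corr\<^sup>2\<close> is at most
  \<open>(1 + 1/n)\<^sup>2 q exp (4 \<lambda> q)\<close>, and \<open>\<lambda> q \<le> 1 / log n\<close>.
\<close>

subsection \<open>Moments and cumulants\<close>

text \<open>W_i is a function of the noise and not of Y. No explicit orthogonal basis is at hand for
  the law of Y, while Hermite polynomials are orthogonal under that of Z; and Cauchy-Schwarz on the
  joint space needs only the second moment of W_i(Z), so no Gram matrix has to be inverted. Cutting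
  W_i at degree D is harmless, since monomials of degree at most D are orthogonal to higher Hermite
  terms. The obstacle is the top layer: correlating a polynomial of degree D with X_i brings in
  cumulants of order D + 1, one more than the sign hypothesis covers. The constant 4 in the exponent
  is the price of that layer. The level D (log n)^2 comes from a comparison of exponents. For k up
  to D + 1, the sub-Weibull growth of the overlap moments and the lower bound n^(-C_1) for the
  quantile cost together a factor n^(O(D)). The tail probability at that level is n^(-D log n),
  which wins as soon as log n exceeds a constant.\<close>

lemma moment_eq_sum_cumulants:
  fixes m :: "'j set \<Rightarrow> real" and \<kappa> :: "'j set \<Rightarrow> real"
  assumes \<kappa>: "\<And>B. B \<noteq> {} \<Longrightarrow> \<kappa> B = (\<Sum>\<pi> | partition_on B \<pi>.
      (-1) ^ (card \<pi> - 1) * fact (card \<pi> - 1) * (\<Prod>C\<in>\<pi>. m C))"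
    and fin: "finite J" and j: "j \<in> J" and m0: "m {} = 1"
  shows "m J = (\<Sum>B | B \<subseteq> J \<and> j \<in> B. \<kappa> B * m (J - B))"
proof -
  define c :: "nat \<Rightarrow> real" where "c = (\<lambda>k. (-1) ^ (k - 1) * fact (k - 1))"
  define Part where "Part = (\<lambda>B :: 'j set. {\<pi>. partition_on B \<pi>})"
  \<comment> \<open>The set \<open>B = J\<close> is kept apart: it contributes
    \<open>\<kappa> J\<close> because \<open>m {} = 1\<close>, and its complement could not serve as
    a block of a partition.\<close>
  define S where "S = {B. B \<subset> J \<and> j \<in> B}"
  have finS: "finite S" unfolding S_def by (rule finite_subset[of _ "Pow J"]) (use fin in auto)
  have finPart: "finite (Part B)" if "B \<subseteq> J" for B
    unfolding Part_def using finitely_many_partition_on finite_subset[OF that fin] by blast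
  have fin\<pi>: "finite \<pi>" if "\<pi> \<in> Part B" "B \<subseteq> J" for \<pi> B
    using that finite_elements[of B \<pi>] finite_subset[OF _ fin] by (auto simp: Part_def)
  have card_noj: "card {C \<in> \<sigma>. j \<notin> C} = card \<sigma> - 1" if "\<sigma> \<in> Part J" for \<sigma>
  proof -
    have p: "partition_on J \<sigma>" using that by (simp add: Part_def)
    obtain B where B: "B \<in> \<sigma>" "j \<in> B" using partition_onD1[OF p] j by auto
    have "{C \<in> \<sigma>. j \<notin> C} = \<sigma> - {B}"
      using B partition_onD2[OF p] by (auto simp: disjoint_def)
    then show ?thesis using B by simp
  qed
  have ne: "card \<sigma> \<ge> 1" if "\<sigma> \<in> Part J" for \<sigma>
  proof -
    have "\<sigma> \<noteq> {}" using that j by (auto simp: Part_def partition_on_def)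
    then show ?thesis using fin\<pi>[OF that order_refl] by (simp add: Suc_leI card_gt_0_iff)
  qed
  have one: "(\<Sum>\<sigma>\<in>Part J. (if card \<sigma> = 1 then \<Prod>C\<in>\<sigma>. m C else 0)) = m J"
  proof -
    have "{\<sigma> \<in> Part J. card \<sigma> = 1} = {{J}}"
      using j by (auto simp: Part_def card_1_singleton_iff partition_on_def)
    then show ?thesis
      using finPart[OF order_refl] by (simp add: sum.inter_filter[symmetric])
  qed
  have "(\<Sum>B\<in>S. \<kappa> B * m (J - B))
      = (\<Sum>B\<in>S. \<Sum>\<pi>\<in>Part B. c (card \<pi>) * (\<Prod>C\<in>\<pi>. m C) * m (J - B))"
  proof (intro sum.cong refl)
    fix B assume "B \<in> S"
    then have "B \<noteq> {}" by (auto simp: S_def)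
    then show "\<kappa> B * m (J - B) = (\<Sum>\<pi>\<in>Part B. c (card \<pi>) * (\<Prod>C\<in>\<pi>. m C) * m (J - B))"
      using \<kappa>[of B] by (simp add: Part_def c_def sum_distrib_right)
  qed
  also have "\<dots> = (\<Sum>(B, \<pi>)\<in>Sigma S Part. c (card \<pi>) * (\<Prod>C\<in>\<pi>. m C) * m (J - B))"
    by (subst sum.Sigma) (use finS finPart in \<open>auto simp: S_def\<close>)
  \<comment> \<open>Adding \<open>J - B\<close> to a partition of \<open>B\<close> gives a partition
    of \<open>J\<close> with one marked block that avoids \<open>j\<close>, and every such pair
    arises once. A partition into k blocks therefore occurs k - 1 times.\<close>
  also have "\<dots> = (\<Sum>(\<sigma>, C)\<in>Sigma (Part J) (\<lambda>\<sigma>. {C \<in> \<sigma>. j \<notin> C}). c (card \<sigma> - 1) * (\<Prod>C\<in>\<sigma>. m C))"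
  proof (rule sum.reindex_bij_witness[where j = "\<lambda>(B, \<pi>). (insert (J - B) \<pi>, J - B)"
        and i = "\<lambda>(\<sigma>, C). (J - C, \<sigma> - {C})"], goal_cases)
    case (1 p)
    then obtain B \<pi> where p: "p = (B, \<pi>)" "B \<subset> J" "j \<in> B" "partition_on B \<pi>"
      by (auto simp: S_def Part_def)
    have "J - B \<notin> \<pi>" using p partition_onD1[OF p(4)] by auto
    then show ?case using p by auto
  next
    case (2 p)
    then obtain B \<pi> where p: "p = (B, \<pi>)" "B \<subset> J" "j \<in> B" "partition_on B \<pi>"
      by (auto simp: S_def Part_def)
    have "partition_on J (insert (J - B) \<pi>)"
      using p partition_onD1[OF p(4)]
      by (subst partition_on_insert) (auto simp: disjnt_iff double_diff)
    then show ?case using p by (auto simp: Part_def)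
  next
    case (3 p)
    then obtain \<sigma> C where p: "p = (\<sigma>, C)" "partition_on J \<sigma>" "C \<in> \<sigma>" "j \<notin> C"
      by (auto simp: Part_def)
    have "C \<subseteq> J" using p by (auto simp: partition_on_def)
    then show ?case using p by (auto simp: double_diff)
  next
    case (4 p)
    then obtain \<sigma> C where p: "p = (\<sigma>, C)" "partition_on J \<sigma>" "C \<in> \<sigma>" "j \<notin> C"
      by (auto simp: Part_def)
    have C: "C \<subseteq> J" "C \<noteq> {}" using p by (auto simp: partition_on_def)
    have "partition_on (J - C) (\<sigma> - {C})"
    proof (subst partition_on_insert[of C "\<sigma> - {C}" J, THEN iffD1, THEN conjunct1])
      show "disjnt C (\<Union> (\<sigma> - {C}))" using p by (auto simp: partition_on_def disjoint_def disjnt_def)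
      show "partition_on J (insert C (\<sigma> - {C}))" using p by (simp add: insert_absorb)
    qed simp
    then show ?case using p C j by (auto simp: Part_def S_def)
  next
    case (5 p)
    then obtain B \<pi> where p: "p = (B, \<pi>)" "B \<subset> J" "j \<in> B" "partition_on B \<pi>"
      by (auto simp: S_def Part_def)
    have "J - B \<notin> \<pi>" using p partition_onD1[OF p(4)] by auto
    moreover have "finite \<pi>" using fin\<pi>[of \<pi> B] p by (auto simp: Part_def)
    ultimately show ?case using p by (simp add: mult_ac)
  qed
  also have "\<dots> = (\<Sum>\<sigma>\<in>Part J. (real (card \<sigma>) - 1) * c (card \<sigma> - 1) * (\<Prod>C\<in>\<sigma>. m C))"
    by (subst sum.Sigma[symmetric])
       (use finPart[OF order_refl] fin\<pi>[of _ J] ne in \<open>auto simp: card_noj of_nat_diff mult.assoc intro!: sum.cong\<close>)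
  finally have *: "(\<Sum>B\<in>S. \<kappa> B * m (J - B))
      = (\<Sum>\<sigma>\<in>Part J. (real (card \<sigma>) - 1) * c (card \<sigma> - 1) * (\<Prod>C\<in>\<sigma>. m C))" .
  \<comment> \<open>The Moebius coefficients satisfy (k - 1) c(k - 1) = - c(k) for k > 1, so only
    the one-block partition survives. At k = 1 the factor k - 1 kills the meaningless value
    \<open>c 0\<close>.\<close>
  have c: "c k + (real k - 1) * c (k - 1) = (if k = 1 then 1 else 0)" if k: "k \<ge> 1" for k
  proof -
    obtain l where "k = Suc l" using k by (cases k) auto
    then show ?thesis by (cases l) (auto simp: c_def algebra_simps)
  qed
  have "{B. B \<subseteq> J \<and> j \<in> B} = insert J S" "J \<notin> S" using j by (auto simp: S_def)
  then have "(\<Sum>B | B \<subseteq> J \<and> j \<in> B. \<kappa> B * m (J - B)) = \<kappa> J + (\<Sum>B\<in>S. \<kappa> B * m (J - B))"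
    using finS m0 by simp
  also have "\<kappa> J = (\<Sum>\<sigma>\<in>Part J. c (card \<sigma>) * (\<Prod>C\<in>\<sigma>. m C))"
    using \<kappa>[of J] j by (auto simp: Part_def c_def)
  also have "\<dots> + (\<Sum>B\<in>S. \<kappa> B * m (J - B)) = (\<Sum>\<sigma>\<in>Part J. (c (card \<sigma>) + (real (card \<sigma>) - 1) * c (card \<sigma> - 1)) * (\<Prod>C\<in>\<sigma>. m C))"
    unfolding * by (simp add: sum.distrib[symmetric] algebra_simps)
  also have "\<dots> = (\<Sum>\<sigma>\<in>Part J. (if card \<sigma> = 1 then \<Prod>C\<in>\<sigma>. m C else 0))"
    by (intro sum.cong refl) (use ne c in auto)
  finally show ?thesis using one by simp
qed

lemma joint_cumulant_reindex:
  assumes f: "bij_betw f J' J" and fin: "finite J"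
    and Y: "\<And>j. j \<in> J' \<Longrightarrow> Y (f j) = Y' j"
  shows "joint_cumulant M J Y = joint_cumulant M J' Y'"
proof -
  have inj: "inj_on f J'" and im: "f ` J' = J" using f by (auto simp: bij_betw_def)
  have im': "inv_into J' f ` J = J'" and inj': "inj_on (inv_into J' f) J"
    using bij_betw_inv_into[OF f] by (auto simp: bij_betw_def)
  have ne: "{} \<notin> \<pi>" if "partition_on A \<pi>" for A :: "'x set" and \<pi>
    using that by (auto simp: partition_on_def)
  have inv1: "f ` (inv_into J' f ` B) = B" if "B \<subseteq> J" for B
    using that im by (force simp: image_image f_inv_into_f subset_iff)
  have inv2: "inv_into J' f ` (f ` B) = B" if "B \<subseteq> J'" for B
    using that inj by (metis inv_into_image_cancel)
  have "(\<Sum>\<pi> | partition_on J \<pi>. (-1) ^ (card \<pi> - 1) * fact (card \<pi> - 1) * (\<Prod>B\<in>\<pi>. \<integral>\<omega>. (\<Prod>j\<in>B. Y j \<omega>) \<partial>M))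
     = (\<Sum>\<pi> | partition_on J' \<pi>. (-1) ^ (card \<pi> - 1) * fact (card \<pi> - 1) * (\<Prod>B\<in>\<pi>. \<integral>\<omega>. (\<Prod>j\<in>B. Y' j \<omega>) \<partial>M))"
  proof (rule sum.reindex_bij_witness[where i = "(`) ((`) f)" and j = "(`) ((`) (inv_into J' f))"], goal_cases)
    case (1 \<pi>)
    then have "(\<lambda>B. f ` (inv_into J' f ` B)) ` \<pi> = (\<lambda>B. B) ` \<pi>"
      by (intro image_cong refl inv1) (auto dest: partition_onD1)
    then show ?case by (simp add: image_image)
  next
    case (2 \<pi>)
    then have "(`) (inv_into J' f) ` \<pi> - {{}} = (`) (inv_into J' f) ` \<pi>"
      using ne[of J \<pi>] by auto
    with 2 show ?case using partition_on_inj_image[of J \<pi> "inv_into J' f"] inj' im' by auto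
  next
    case (3 \<pi>)
    then have "(\<lambda>B. inv_into J' f ` (f ` B)) ` \<pi> = (\<lambda>B. B) ` \<pi>"
      by (intro image_cong refl inv2) (auto dest: partition_onD1)
    then show ?case by (simp add: image_image)
  next
    case (4 \<pi>)
    then have "(`) f ` \<pi> - {{}} = (`) f ` \<pi>"
      using ne[of J' \<pi>] by auto
    with 4 show ?case using partition_on_inj_image[of J' \<pi> f] inj im by auto
  next
    case (5 \<pi>)
    have inj\<pi>: "inj_on ((`) (inv_into J' f)) \<pi>"
      using 5 by (intro inj_on_inverseI[where g = "(`) f"] inv1) (auto dest: partition_onD1)
    have "(\<Prod>j\<in>inv_into J' f ` B. Y' j \<omega>) = (\<Prod>j\<in>B. Y j \<omega>)" if "B \<in> \<pi>" for B \<omega>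
    proof -
      have B: "B \<subseteq> J" using 5 that by (auto dest: partition_onD1)
      have "(\<Prod>j\<in>inv_into J' f ` B. Y' j \<omega>) = (\<Prod>j\<in>B. Y' (inv_into J' f j) \<omega>)"
        using inj_on_subset[OF inj' B] by (simp add: prod.reindex)
      also have "\<dots> = (\<Prod>j\<in>B. Y j \<omega>)"
        by (intro prod.cong refl) (metis B Y f_inv_into_f im inv_into_into subsetD)
      finally show ?thesis .
    qed
    then show ?case
      by (simp add: card_image[OF inj\<pi>] prod.reindex[OF inj\<pi>])
  qed
  then show ?thesis using im by (auto simp: joint_cumulant_def)
qed

subsection \<open>Monomials indexed by sets of labels\<close>

text \<open>
  A monomial is written as a product over a set of labels, the label \<open>(i, k)\<close> standing for the \<open>k\<close>-th
  copy of the \<open>i\<close>-th variable. Expansions then run over subsets, without binomial coefficients.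
\<close>

definition cnt :: "(nat \<times> nat) set \<Rightarrow> nat \<Rightarrow> nat" where
  "cnt L i = card {k. (i, k) \<in> L}"

definition labels :: "nat \<Rightarrow> (nat \<times> nat) set \<Rightarrow> bool" where
  "labels n L \<longleftrightarrow> finite L \<and> fst ` L \<subseteq> {..<n}"

lemma labels_subset: "labels n L \<Longrightarrow> A \<subseteq> L \<Longrightarrow> labels n A"
  by (auto simp: labels_def intro: finite_subset)

lemma labels_finite: "labels n L \<Longrightarrow> finite L"
  by (simp add: labels_def)

lemma finite_fibre: "finite L \<Longrightarrow> finite {k. (i, k) \<in> L}"
  by (rule finite_subset[of _ "snd ` L"]) force+

lemma prod_labels:
  assumes "labels n L"
  shows "(\<Prod>j\<in>L. x (fst j)) = (\<Prod>i<n. x i ^ cnt L i :: real)"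
proof -
  have "(\<Prod>j\<in>L. x (fst j)) = (\<Prod>i<n. \<Prod>j\<in>{j \<in> L. fst j = i}. x (fst j))"
    using assms by (intro prod.group[symmetric]) (auto simp: labels_def)
  also have "\<dots> = (\<Prod>i<n. x i ^ cnt L i)"
  proof (intro prod.cong refl)
    fix i
    have "{j \<in> L. fst j = i} = Pair i ` {k. (i, k) \<in> L}" by force
    then have "card {j \<in> L. fst j = i} = cnt L i"
      by (simp add: cnt_def card_image inj_on_def)
    then show "(\<Prod>j\<in>{j \<in> L. fst j = i}. x (fst j)) = x i ^ cnt L i"
      by simp
  qed
  finally show ?thesis .
qed

text \<open>Evaluating the monomial at the constant 2 turns the product formula into an equality of
  exponents.\<close>

lemma sum_cnt:
  assumes "labels n L"
  shows "(\<Sum>i<n. cnt L i) = card L"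
proof -
  have "2 ^ card L = (2 :: real) ^ (\<Sum>i<n. cnt L i)"
    using prod_labels[OF assms, of "\<lambda>_. 2"] by (simp add: power_sum)
  then show ?thesis by simp
qed

lemma cnt_outside: "labels n L \<Longrightarrow> i \<ge> n \<Longrightarrow> cnt L i = 0"
proof -
  assume "labels n L" "i \<ge> n"
  then have "{k. (i, k) \<in> L} = {}" by (force simp: labels_def)
  then show ?thesis by (simp add: cnt_def)
qed

lemma cnt_multi_indices: "labels n L \<Longrightarrow> card L \<le> D \<Longrightarrow> cnt L \<in> multi_indices n D"
  by (simp add: multi_indices_def sum_cnt cnt_outside)

text \<open>The label set on which \<open>cumulant\<close> is defined. In row \<open>i\<close> the
  first free label is \<open>(i, \<alpha> i)\<close>; adding it later stands for one further copy of
  the i-th variable.\<close>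

definition copies :: "nat \<Rightarrow> (nat \<Rightarrow> nat) \<Rightarrow> (nat \<times> nat) set" where
  "copies n \<alpha> = (SIGMA i:{..<n}. {..<\<alpha> i})"

lemma labels_copies: "labels n (copies n \<alpha>)"
  by (auto simp: labels_def copies_def)

lemma cnt_copies: "(\<And>i. i \<ge> n \<Longrightarrow> \<alpha> i = 0) \<Longrightarrow> cnt (copies n \<alpha>) = \<alpha>"
proof
  fix i assume a: "\<And>i. i \<ge> n \<Longrightarrow> \<alpha> i = 0"
  have "{k. (i, k) \<in> copies n \<alpha>} = {..<\<alpha> i}"
    using a[of i] by (cases "i < n") (auto simp: copies_def)
  then show "cnt (copies n \<alpha>) i = \<alpha> i" by (simp add: cnt_def)
qed

text \<open>The recursion removes arbitrary labels, so the remaining rows are no longer initial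
  segments. Renumbering each row separately leads back to the canonical labels, and cumulants are
  thereby functions of the counts alone.\<close>

lemma joint_cumulant_labels:
  assumes L: "labels n L"
  shows "joint_cumulant (measure_pmf P) L (\<lambda>(i, k) x. x i) = cumulant n P (cnt L)"
proof -
  have "\<exists>h. bij_betw h {k. (i, k) \<in> L} {..<cnt L i}" for i
    using ex_bij_betw_finite_nat[OF finite_fibre[OF labels_finite[OF L]], of i]
    by (auto simp: cnt_def atLeast0LessThan)
  then obtain h where h: "\<And>i. bij_betw (h i) {k. (i, k) \<in> L} {..<cnt L i}" by metis
  have "bij_betw (\<lambda>(i, k). (i, h i k)) (SIGMA i:{..<n}. {k. (i, k) \<in> L}) (SIGMA i:{..<n}. {..<cnt L i})"
    unfolding bij_betw_def
  proof
    show "inj_on (\<lambda>(i, k). (i, h i k)) (SIGMA i:{..<n}. {k. (i, k) \<in> L})"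
      using h by (auto simp: inj_on_def bij_betw_def)
    have eq: "h i ` {k. (i, k) \<in> L} = {..<cnt L i}" for i using h by (auto simp: bij_betw_def)
    have "h i k < cnt L i" if "(i, k) \<in> L" for i k using eq[of i] that by auto
    moreover have "\<exists>k. (i, k) \<in> L \<and> h i k = l" if "l < cnt L i" for i l
      using eq[of i] that by (metis (mono_tags, lifting) imageE lessThan_iff mem_Collect_eq)
    ultimately show "(\<lambda>(i, k). (i, h i k)) ` (SIGMA i:{..<n}. {k. (i, k) \<in> L}) = (SIGMA i:{..<n}. {..<cnt L i})"
      by (auto simp: image_iff Bex_def) metis
  qed
  moreover have "(SIGMA i:{..<n}. {k. (i, k) \<in> L}) = L"
    using L by (force simp: labels_def)
  ultimately have "bij_betw (\<lambda>(i, k). (i, h i k)) L (SIGMA i:{..<n}. {..<cnt L i})" by simp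
  then show ?thesis
    unfolding cumulant_def
    by (intro joint_cumulant_reindex[symmetric, where f = "\<lambda>(i, k). (i, h i k)"]) auto
qed

text \<open>A subset is an independent choice in every row. This is the one place where sums over
  label sets meet the binomial coefficients produced by the one-variable Hermite integrals.\<close>

lemma card_subsets_cnt:
  assumes L: "labels n L" and \<alpha>: "\<And>i. i \<ge> n \<Longrightarrow> \<alpha> i = 0"
  shows "card {A. A \<subseteq> L \<and> cnt A = \<alpha>} = (\<Prod>i<n. cnt L i choose \<alpha> i)"
proof -
  let ?F = "\<lambda>i. {k. (i, k) \<in> L}"
  have "card {A. A \<subseteq> L \<and> cnt A = \<alpha>} = card (\<Pi>\<^sub>E i\<in>{..<n}. {S. S \<subseteq> ?F i \<and> card S = \<alpha> i})"
  proof (rule bij_betw_same_card, rule bij_betw_byWitness[where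
        f = "\<lambda>A. restrict (\<lambda>i. {k. (i, k) \<in> A}) {..<n}" and f' = "\<lambda>S. SIGMA i:{..<n}. S i"], goal_cases)
    case 1
    then show ?case using L by (force simp: labels_def)
  next
    case 2
    show ?case by (auto simp: PiE_iff extensional_def fun_eq_iff)
  next
    case 3
    show ?case by (auto simp: cnt_def)
  next
    case 4
    show ?case
    proof (rule image_subsetI, safe)
      fix S i k assume S: "S \<in> (\<Pi>\<^sub>E i\<in>{..<n}. {S. S \<subseteq> ?F i \<and> card S = \<alpha> i})"
      show "i < n \<Longrightarrow> k \<in> S i \<Longrightarrow> (i, k) \<in> L"
        using S by (auto simp: PiE_iff)
      show "cnt (SIGMA i:{..<n}. S i) = \<alpha>"
      proof
        fix i show "cnt (SIGMA i:{..<n}. S i) i = \<alpha> i"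
          using S \<alpha>[of i] by (cases "i < n") (auto simp: PiE_iff cnt_def)
      qed
    qed
  qed
  also have "\<dots> = (\<Prod>i<n. cnt L i choose \<alpha> i)"
    using finite_fibre[OF labels_finite[OF L]]
    by (simp add: card_PiE n_subsets cnt_def)
  finally show ?thesis .
qed

lemma cnt_Diff: "finite L \<Longrightarrow> A \<subseteq> L \<Longrightarrow> cnt (L - A) i = cnt L i - cnt A i"
proof -
  assume *: "finite L" "A \<subseteq> L"
  have "{k. (i, k) \<in> L - A} = {k. (i, k) \<in> L} - {k. (i, k) \<in> A}" by auto
  then show ?thesis
    using * finite_fibre[OF finite_subset[OF *(2,1)], of i]
    by (auto simp: cnt_def intro!: card_Diff_subset)
qed

subsection \<open>Hermite polynomials\<close>

abbreviation std_normal :: "real measure" where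
  "std_normal \<equiv> density lborel std_normal_density"

lemma integrable_std_normal_power: "integrable std_normal (\<lambda>x. x ^ k)"
  by (subst integrable_density) (simp_all add: integrable_std_normal_moment)

lemma integrable_std_normal_poly: "integrable std_normal (poly p)"
  unfolding poly_altdef using integrable_std_normal_power by (intro Bochner_Integration.integrable_sum integrable_mult_right) simp

definition gexp :: "real poly \<Rightarrow> real" where
  "gexp p = (\<integral>x. poly p x \<partial>std_normal)"

lemma gexp_add: "gexp (p + q) = gexp p + gexp q"
  and gexp_diff: "gexp (p - q) = gexp p - gexp q"
  and gexp_smult: "gexp (smult c p) = c * gexp p"
proof -
  have eq: "poly (p + q) = (\<lambda>x. poly p x + poly q x)" "poly (p - q) = (\<lambda>x. poly p x - poly q x)"
    "poly (smult c p) = (\<lambda>x. c * poly p x)"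
    by auto
  show "gexp (p + q) = gexp p + gexp q" "gexp (p - q) = gexp p - gexp q" "gexp (smult c p) = c * gexp p"
    unfolding gexp_def eq using integrable_std_normal_poly by auto
qed

lemma gexp_0: "gexp 0 = 0"
  by (simp add: gexp_def)

lemma gexp_sum: "gexp (sum f A) = (\<Sum>i\<in>A. gexp (f i))"
  by (induction A rule: infinite_finite_induct) (auto simp: gexp_add gexp_0)

lemma gexp_monom_even: "gexp (monom 1 (2 * k)) = fact (2 * k) / (2 ^ k * fact k)"
  unfolding gexp_def poly_monom
  by (subst integral_density) (simp_all add: integral_std_normal_moment_even)

lemma gexp_monom_odd: "gexp (monom 1 (2 * k + 1)) = 0"
  unfolding gexp_def poly_monom
  using integral_std_normal_moment_odd[of k] by (subst integral_density) simp_all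

text \<open>For even \<open>k\<close> both sides are odd moments and vanish, except that at
  \<open>k = 0\<close> the right side is killed by its factor and not by the truncated exponent. For
  odd \<open>k\<close> this is the ratio of consecutive even moments.\<close>

lemma gexp_parts_monom: "gexp (monom 1 (Suc k)) = k * gexp (monom 1 (k - 1))"
proof (cases "even k")
  case True
  then obtain l where l: "k = 2 * l" by auto
  show ?thesis using gexp_monom_odd[of l] gexp_monom_odd[of "l - 1"] l by (cases l) auto
next
  case False
  then obtain l where l: "k = 2 * l + 1" using oddE by blast
  have "gexp (monom 1 (Suc k)) = fact (2 * Suc l) / (2 ^ Suc l * fact (Suc l))"
    using gexp_monom_even[of "Suc l"] l by simp
  also have "\<dots> = k * (fact (2 * l) / (2 ^ l * fact l))"
    by (simp add: l divide_simps)
  finally show ?thesis using gexp_monom_even[of l] l by simp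
qed

text \<open>Stein's identity. Linearity reduces it to the known moments, so no boundary terms of an
  integration by parts have to be discussed.\<close>

lemma gexp_parts: "gexp ([:0, 1:] * p) = gexp (pderiv p)"
proof -
  have m: "gexp ([:0, 1:] * monom c k) = gexp (pderiv (monom c k))" for c k
  proof -
    have *: "monom c i = smult c (monom 1 i)" for c :: real and i by (simp add: smult_monom)
    have "[:0, 1:] * monom c k = smult c (monom 1 (Suc k))"
      by (simp add: monom_Suc smult_monom)
    then show ?thesis
      using *[of "of_nat k * c" "k - 1"]
      by (simp add: pderiv_monom gexp_smult gexp_parts_monom)
  qed
  have "gexp ([:0, 1:] * p) = (\<Sum>k\<le>degree p. gexp ([:0, 1:] * monom (coeff p k) k))"
    by (subst poly_as_sum_of_monoms[of p, symmetric], subst sum_distrib_left, rule gexp_sum)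
  also have "\<dots> = (\<Sum>k\<le>degree p. gexp (pderiv (monom (coeff p k) k)))"
    unfolding m ..
  also have "\<dots> = gexp (pderiv p)"
    by (subst (3) poly_as_sum_of_monoms[of p, symmetric])
       (simp add: gexp_sum higher_pderiv_sum[of 1, simplified] del: poly_as_sum_of_monoms)
  finally show ?thesis .
qed

text \<open>The monic (probabilists') Hermite polynomials. The recursion by the raising operator,
  instead of the three-term one, makes the adjointness below immediate.\<close>

fun hermite :: "nat \<Rightarrow> real poly" where
  "hermite 0 = 1"
| "hermite (Suc k) = [:0, 1:] * hermite k - pderiv (hermite k)"

text \<open>By Stein's identity the raising operator is the Gaussian adjoint of differentiation. All
  Hermite integrals follow by moving derivatives onto the other factor.\<close>

lemma gexp_hermite_Suc: "gexp (hermite (Suc k) * p) = gexp (hermite k * pderiv p)"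
proof -
  have "hermite (Suc k) * p = [:0, 1:] * (hermite k * p) - pderiv (hermite k) * p"
    by (simp add: algebra_simps)
  then have "gexp (hermite (Suc k) * p) = gexp (pderiv (hermite k * p)) - gexp (pderiv (hermite k) * p)"
    by (metis gexp_diff gexp_parts)
  also have "\<dots> = gexp (hermite k * pderiv p)"
    by (simp add: gexp_diff[symmetric] pderiv_mult algebra_simps)
  finally show ?thesis .
qed

lemma pderiv_hermite: "pderiv (hermite (Suc k)) = smult (Suc k) (hermite k)"
proof (induction k)
  case 0
  show ?case by (simp add: pderiv_pCons)
next
  case (Suc k)
  have "pderiv (hermite (Suc (Suc k))) =
      hermite (Suc k) + [:0, 1:] * pderiv (hermite (Suc k)) - pderiv (pderiv (hermite (Suc k)))"
    by (subst hermite.simps(2)) (simp add: pderiv_diff pderiv_mult pderiv_pCons algebra_simps del: hermite.simps)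
  also have "\<dots> = hermite (Suc k) + smult (Suc k) ([:0, 1:] * hermite k - pderiv (hermite k))"
    unfolding Suc.IH by (simp add: pderiv_smult smult_diff_right del: hermite.simps)
  also have "\<dots> = smult (Suc (Suc k)) (hermite (Suc k))"
    unfolding hermite.simps(2)[symmetric] of_nat_Suc[of "Suc k"] by (simp only: smult_add_left smult_1_left)
  finally show ?case .
qed

lemma gexp_hermite_hermite: "gexp (hermite a * hermite b) = (if a = b then fact a else 0)"
proof (induction a arbitrary: b)
  case 0
  show ?case
  proof (cases b)
    case 0
    then show ?thesis using gexp_monom_even[of 0] by (simp add: monom_0 one_pCons)
  next
    case (Suc c)
    then have "gexp (hermite 0 * hermite b) = gexp (hermite (Suc c) * 1)" by simp
    also have "\<dots> = 0" unfolding gexp_hermite_Suc by (simp add: gexp_0)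
    finally show ?thesis using Suc by simp
  qed
next
  case (Suc a)
  show ?case
  proof (cases b)
    case 0
    then show ?thesis unfolding gexp_hermite_Suc by (simp add: gexp_0)
  next
    case (Suc c)
    then show ?thesis unfolding gexp_hermite_Suc
      by (simp add: pderiv_hermite gexp_smult Suc.IH del: hermite.simps)
  qed
qed

text \<open>Moving \<open>a\<close> derivatives onto the monomial leaves the falling factorial,
  written as \<open>fact a * (b choose a)\<close>. For \<open>a > b\<close> the binomial coefficient
  is 0, which makes the truncated difference \<open>b - a\<close> harmless.\<close>

lemma gexp_hermite_monom:
  "gexp (hermite a * monom 1 b) = fact a * (b choose a) * gexp (monom 1 (b - a))"
proof (induction a arbitrary: b)
  case 0
  show ?case by simp
next
  case (Suc a)
  show ?case
  proof (cases b)
    case 0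
    then show ?thesis unfolding gexp_hermite_Suc by (simp add: pderiv_monom gexp_0)
  next
    case (Suc c)
    have "monom (real b) c = smult b (monom 1 c)" by (simp add: smult_monom)
    then have "gexp (hermite (Suc a) * monom 1 b) = b * (fact a * (c choose a) * gexp (monom 1 (c - a)))"
      unfolding gexp_hermite_Suc using Suc by (simp add: pderiv_monom gexp_smult Suc.IH)
    also have "\<dots> = (b * (c choose a)) * (fact a * gexp (monom 1 (c - a)))" by simp
    also have "real (b * (c choose a)) = Suc a * (b choose Suc a)"
      unfolding Suc using Suc_times_binomial_eq[of c a] by (simp add: mult.commute)
    finally show ?thesis using Suc by (simp add: algebra_simps)
  qed
qed

subsection \<open>Hermite sums in several variables\<close>

lemma prob_space_std_normal: "prob_space std_normal"
  by (rule prob_space_normal_density) simp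

definition gauss :: "nat \<Rightarrow> (nat \<Rightarrow> real) measure" where
  "gauss n = (\<Pi>\<^sub>M i\<in>{..<n}. std_normal)"

lemma prob_space_gauss: "prob_space (gauss n)"
  unfolding gauss_def by (intro prob_space_PiM prob_space_std_normal)

lemma gauss_prod_poly:
  shows integrable_gauss_prod_poly: "integrable (gauss n) (\<lambda>z. \<Prod>i<n. poly (p i) (z i))"
    and integral_gauss_prod_poly: "(\<integral>z. (\<Prod>i<n. poly (p i) (z i)) \<partial>gauss n) = (\<Prod>i<n. gexp (p i))"
proof -
  interpret product_sigma_finite "\<lambda>_::nat. std_normal"
    by (intro product_sigma_finite.intro prob_space_imp_sigma_finite prob_space_std_normal)
  show "integrable (gauss n) (\<lambda>z. \<Prod>i<n. poly (p i) (z i))"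
    unfolding gauss_def by (intro product_integrable_prod integrable_std_normal_poly) simp
  show "(\<integral>z. (\<Prod>i<n. poly (p i) (z i)) \<partial>gauss n) = (\<Prod>i<n. gexp (p i))"
    unfolding gauss_def gexp_def by (intro product_integral_prod integrable_std_normal_poly) simp
qed

definition lmon :: "(nat \<Rightarrow> real) \<Rightarrow> (nat \<times> nat) set \<Rightarrow> real" where
  "lmon x L = (\<Prod>j\<in>L. x (fst j))"

lemma lmon_poly: "labels n L \<Longrightarrow> lmon x L = (\<Prod>i<n. poly (monom 1 (cnt L i)) (x i))"
  by (simp add: lmon_def prod_labels poly_monom)

definition gmom :: "nat \<Rightarrow> (nat \<times> nat) set \<Rightarrow> real" where
  "gmom n L = (\<integral>z. lmon z L \<partial>gauss n)"

lemma gmom_eq: "labels n L \<Longrightarrow> gmom n L = (\<Prod>i<n. gexp (monom 1 (cnt L i)))"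
  unfolding gmom_def by (simp add: lmon_poly integral_gauss_prod_poly)

text \<open>The division by the factorials makes the pairing with a monomial a plain sum over
  subsets of labels, while the squared norm keeps one factorial in the denominator.\<close>

definition hermite_sum :: "nat \<Rightarrow> nat \<Rightarrow> ((nat \<Rightarrow> nat) \<Rightarrow> real) \<Rightarrow> (nat \<Rightarrow> real) \<Rightarrow> real" where
  "hermite_sum n D w z =
     (\<Sum>\<alpha>\<in>multi_indices n D. w \<alpha> / (\<Prod>i<n. fact (\<alpha> i)) * (\<Prod>i<n. poly (hermite (\<alpha> i)) (z i)))"

lemma integral_hermite_sum_square:
  "(\<integral>z. (hermite_sum n D w z)\<^sup>2 \<partial>gauss n) = (\<Sum>\<alpha>\<in>multi_indices n D. (w \<alpha>)\<^sup>2 / (\<Prod>i<n. fact (\<alpha> i)))"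
proof -
  let ?f = "\<lambda>\<alpha>. (\<Prod>i<n. fact (\<alpha> i)) :: real"
  let ?I = "multi_indices n D"
  have sq: "(hermite_sum n D w z)\<^sup>2 = (\<Sum>\<alpha>\<in>?I. \<Sum>\<beta>\<in>?I. (w \<alpha> / ?f \<alpha>) * (w \<beta> / ?f \<beta>) *
      (\<Prod>i<n. poly (hermite (\<alpha> i) * hermite (\<beta> i)) (z i)))" for z
    by (simp add: hermite_sum_def power2_eq_square sum_product prod.distrib mult_ac)
  have "(\<integral>z. (hermite_sum n D w z)\<^sup>2 \<partial>gauss n) = (\<Sum>\<alpha>\<in>?I. \<Sum>\<beta>\<in>?I. (w \<alpha> / ?f \<alpha>) * (w \<beta> / ?f \<beta>) *
      (\<Prod>i<n. gexp (hermite (\<alpha> i) * hermite (\<beta> i))))"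
    unfolding sq
    by (subst Bochner_Integration.integral_sum | subst integral_mult_right_zero integral_gauss_prod_poly
        | intro sum.cong refl Bochner_Integration.integrable_sum integrable_mult_right integrable_gauss_prod_poly)+
  also have "\<dots> = (\<Sum>\<alpha>\<in>?I. \<Sum>\<beta>\<in>?I. if \<alpha> = \<beta> then (w \<alpha>)\<^sup>2 / ?f \<alpha> else 0)"
  proof (intro sum.cong refl)
    fix \<alpha> \<beta> assume ab: "\<alpha> \<in> ?I" "\<beta> \<in> ?I"
    show "(w \<alpha> / ?f \<alpha>) * (w \<beta> / ?f \<beta>) * (\<Prod>i<n. gexp (hermite (\<alpha> i) * hermite (\<beta> i)))
        = (if \<alpha> = \<beta> then (w \<alpha>)\<^sup>2 / ?f \<alpha> else 0)"
    proof (cases "\<alpha> = \<beta>")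
      case True
      then show ?thesis by (simp add: gexp_hermite_hermite power2_eq_square)
    next
      case False
      \<comment> \<open>Both multi-indices vanish from \<open>n\<close> on, so they differ in a
        coordinate that is integrated out.\<close>
      then obtain i where i: "\<alpha> i \<noteq> \<beta> i" by auto
      then have "i < n" using ab by (cases "i < n") (auto simp: multi_indices_def)
      with i have "(\<Prod>i<n. gexp (hermite (\<alpha> i) * hermite (\<beta> i))) = 0"
        by (intro prod_zero) (auto simp: gexp_hermite_hermite)
      then show ?thesis using False by simp
    qed
  qed
  also have "\<dots> = (\<Sum>\<alpha>\<in>?I. (w \<alpha>)\<^sup>2 / ?f \<alpha>)"
    by (simp add: finite_multi_indices)
  finally show ?thesis .
qed

text \<open>The integral against a single Hermite product is the factorial of \<alpha> times the
  number of subsets with count \<alpha>, times a moment of the remaining labels. The factorial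
  cancels the normalisation, and the multiplicity is absorbed by summing over the subsets
  themselves.\<close>

lemma integral_hermite_sum_lmon:
  assumes L: "labels n L" and D: "card L \<le> D"
  shows "(\<integral>z. hermite_sum n D w z * lmon z L \<partial>gauss n) = (\<Sum>A\<in>Pow L. w (cnt A) * gmom n (L - A))"
proof -
  let ?f = "\<lambda>\<alpha>. (\<Prod>i<n. fact (\<alpha> i)) :: real"
  let ?I = "multi_indices n D"
  have eq: "hermite_sum n D w z * lmon z L
      = (\<Sum>\<alpha>\<in>?I. w \<alpha> / ?f \<alpha> * (\<Prod>i<n. poly (hermite (\<alpha> i) * monom 1 (cnt L i)) (z i)))" for z
    unfolding hermite_sum_def lmon_poly[OF L] sum_distrib_right
    by (intro sum.cong refl) (simp add: prod.distrib)
  have "(\<integral>z. hermite_sum n D w z * lmon z L \<partial>gauss n)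
      = (\<Sum>\<alpha>\<in>?I. w \<alpha> / ?f \<alpha> * (\<Prod>i<n. gexp (hermite (\<alpha> i) * monom 1 (cnt L i))))"
    unfolding eq
    by (subst Bochner_Integration.integral_sum | subst integral_mult_right_zero integral_gauss_prod_poly
        | intro sum.cong refl integrable_mult_right integrable_gauss_prod_poly)+
  also have "\<dots> = (\<Sum>\<alpha>\<in>?I. \<Sum>A\<in>{A \<in> Pow L. cnt A = \<alpha>}. w (cnt A) * gmom n (L - A))"
  proof (intro sum.cong refl)
    fix \<alpha> assume \<alpha>: "\<alpha> \<in> ?I"
    have "(\<Prod>i<n. gexp (hermite (\<alpha> i) * monom 1 (cnt L i)))
        = ?f \<alpha> * real (\<Prod>i<n. cnt L i choose \<alpha> i) * (\<Prod>i<n. gexp (monom 1 (cnt L i - \<alpha> i)))"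
      by (simp add: gexp_hermite_monom prod.distrib)
    then have "w \<alpha> / ?f \<alpha> * (\<Prod>i<n. gexp (hermite (\<alpha> i) * monom 1 (cnt L i)))
        = real (card {A. A \<subseteq> L \<and> cnt A = \<alpha>}) * (w \<alpha> * (\<Prod>i<n. gexp (monom 1 (cnt L i - \<alpha> i))))"
      using \<alpha> by (subst card_subsets_cnt[OF L]) (auto simp: multi_indices_def)
    also have "\<dots> = (\<Sum>A\<in>{A \<in> Pow L. cnt A = \<alpha>}. w \<alpha> * (\<Prod>i<n. gexp (monom 1 (cnt L i - \<alpha> i))))"
      by simp
    also have "\<dots> = (\<Sum>A\<in>{A \<in> Pow L. cnt A = \<alpha>}. w (cnt A) * gmom n (L - A))"
      using L by (intro sum.cong refl)
        (auto simp: gmom_eq labels_subset cnt_Diff labels_finite Diff_subset)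
    finally show "w \<alpha> / ?f \<alpha> * (\<Prod>i<n. gexp (hermite (\<alpha> i) * monom 1 (cnt L i)))
        = (\<Sum>A\<in>{A \<in> Pow L. cnt A = \<alpha>}. w (cnt A) * gmom n (L - A))" .
  qed
  \<comment> \<open>Grouping by \<open>cnt\<close> loses nothing: as \<open>card L \<le> D\<close>,
    the count of each subset lies in the truncated index set.\<close>
  also have "\<dots> = (\<Sum>A\<in>Pow L. w (cnt A) * gmom n (L - A))"
    using L D card_mono[OF labels_finite[OF L]]
    by (intro sum.group) (auto simp: finite_multi_indices labels_finite intro!: cnt_multi_indices
      elim: labels_subset intro: order_trans)
  finally show ?thesis .
qed

subsection \<open>Random variables with all moments\<close>

text \<open>Absolute moments of every order define a class closed under sums and products, so that
  integrability of each polynomial expression is settled by its shape.\<close>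

definition all_moments :: "'w measure \<Rightarrow> ('w \<Rightarrow> real) \<Rightarrow> bool" where
  "all_moments M f \<longleftrightarrow> f \<in> borel_measurable M \<and> (\<forall>k. integrable M (\<lambda>\<omega>. \<bar>f \<omega>\<bar> ^ k))"

lemma all_moments_integrable: "all_moments M f \<Longrightarrow> integrable M f"
  unfolding all_moments_def by (auto dest!: spec[of _ 1] intro: integrable_abs_cancel)

lemma all_moments_const: "prob_space M \<Longrightarrow> all_moments M (\<lambda>_. c)"
proof -
  assume "prob_space M"
  then interpret prob_space M .
  show ?thesis by (simp add: all_moments_def)
qed

lemma all_moments_mult:
  assumes f: "all_moments M f" and g: "all_moments M g"
  shows "all_moments M (\<lambda>\<omega>. f \<omega> * g \<omega>)"
  unfolding all_moments_def
proof (intro conjI allI)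
  have [measurable]: "f \<in> borel_measurable M" "g \<in> borel_measurable M"
    using f g by (auto simp: all_moments_def)
  show "(\<lambda>\<omega>. f \<omega> * g \<omega>) \<in> borel_measurable M" by measurable
  fix k
  show "integrable M (\<lambda>\<omega>. \<bar>f \<omega> * g \<omega>\<bar> ^ k)"
  proof (rule Bochner_Integration.integrable_bound)
    show "integrable M (\<lambda>\<omega>. \<bar>f \<omega>\<bar> ^ (2 * k) + \<bar>g \<omega>\<bar> ^ (2 * k))"
      using f g by (auto simp: all_moments_def)
    have "\<bar>a * b\<bar> ^ k \<le> \<bar>a\<bar> ^ (2 * k) + \<bar>b\<bar> ^ (2 * k)" for a b :: real
    proof -
      have "0 \<le> (\<bar>a\<bar> ^ k - \<bar>b\<bar> ^ k)\<^sup>2" by simp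
      then have "2 * (\<bar>a\<bar> ^ k * \<bar>b\<bar> ^ k) \<le> (\<bar>a\<bar> ^ k)\<^sup>2 + (\<bar>b\<bar> ^ k)\<^sup>2"
        by (simp add: power2_diff)
      moreover have "0 \<le> \<bar>a\<bar> ^ k * \<bar>b\<bar> ^ k" by simp
      ultimately have "\<bar>a\<bar> ^ k * \<bar>b\<bar> ^ k \<le> (\<bar>a\<bar> ^ k)\<^sup>2 + (\<bar>b\<bar> ^ k)\<^sup>2" by linarith
      then show ?thesis by (simp add: abs_mult power_mult_distrib power_mult mult.commute[of 2])
    qed
    then show "AE \<omega> in M. norm (\<bar>f \<omega> * g \<omega>\<bar> ^ k) \<le> norm (\<bar>f \<omega>\<bar> ^ (2 * k) + \<bar>g \<omega>\<bar> ^ (2 * k))"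
      by (intro AE_I2) (simp del: abs_mult)
  qed measurable
qed

lemma all_moments_add:
  assumes f: "all_moments M f" and g: "all_moments M g"
  shows "all_moments M (\<lambda>\<omega>. f \<omega> + g \<omega>)"
  unfolding all_moments_def
proof (intro conjI allI)
  have [measurable]: "f \<in> borel_measurable M" "g \<in> borel_measurable M"
    using f g by (auto simp: all_moments_def)
  show "(\<lambda>\<omega>. f \<omega> + g \<omega>) \<in> borel_measurable M" by measurable
  fix k
  show "integrable M (\<lambda>\<omega>. \<bar>f \<omega> + g \<omega>\<bar> ^ k)"
  proof (rule Bochner_Integration.integrable_bound)
    show "integrable M (\<lambda>\<omega>. 2 ^ k * (\<bar>f \<omega>\<bar> ^ k + \<bar>g \<omega>\<bar> ^ k))"
      using f g by (auto simp: all_moments_def)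
    have "\<bar>a + b\<bar> ^ k \<le> 2 ^ k * (\<bar>a\<bar> ^ k + \<bar>b\<bar> ^ k)" for a b :: real
    proof -
      have "\<bar>a + b\<bar> ^ k \<le> (2 * max \<bar>a\<bar> \<bar>b\<bar>) ^ k" by (intro power_mono) auto
      also have "\<dots> \<le> 2 ^ k * (\<bar>a\<bar> ^ k + \<bar>b\<bar> ^ k)"
        by (simp add: power_mult_distrib max_def)
      finally show ?thesis .
    qed
    then show "AE \<omega> in M. norm (\<bar>f \<omega> + g \<omega>\<bar> ^ k) \<le> norm (2 ^ k * (\<bar>f \<omega>\<bar> ^ k + \<bar>g \<omega>\<bar> ^ k))"
      by (intro AE_I2) (simp add: abs_mult)
  qed measurable
qed

lemma all_moments_prod:
  assumes "prob_space M" "\<And>i. i \<in> A \<Longrightarrow> all_moments M (f i)"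
  shows "all_moments M (\<lambda>\<omega>. \<Prod>i\<in>A. f i \<omega>)"
  using assms(2) by (induction A rule: infinite_finite_induct)
    (auto intro: all_moments_const all_moments_mult assms(1))

lemma all_moments_sum:
  assumes "prob_space M" "\<And>i. i \<in> A \<Longrightarrow> all_moments M (f i)"
  shows "all_moments M (\<lambda>\<omega>. \<Sum>i\<in>A. f i \<omega>)"
  using assms(2) by (induction A rule: infinite_finite_induct)
    (auto intro: all_moments_const all_moments_add assms(1))

lemma all_moments_power:
  "prob_space M \<Longrightarrow> all_moments M f \<Longrightarrow> all_moments M (\<lambda>\<omega>. f \<omega> ^ k)"
  using all_moments_prod[of M "{..<k}" "\<lambda>_. f"] by simp

lemma Cauchy_Schwarz_integral:
  fixes f g :: "'w \<Rightarrow> real"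
  assumes "integrable M (\<lambda>\<omega>. (f \<omega>)\<^sup>2)" "integrable M (\<lambda>\<omega>. (g \<omega>)\<^sup>2)" "integrable M (\<lambda>\<omega>. f \<omega> * g \<omega>)"
  shows "(\<integral>\<omega>. f \<omega> * g \<omega> \<partial>M)\<^sup>2 \<le> (\<integral>\<omega>. (f \<omega>)\<^sup>2 \<partial>M) * (\<integral>\<omega>. (g \<omega>)\<^sup>2 \<partial>M)"
proof -
  let ?a = "\<integral>\<omega>. (f \<omega>)\<^sup>2 \<partial>M" and ?b = "\<integral>\<omega>. f \<omega> * g \<omega> \<partial>M" and ?c = "\<integral>\<omega>. (g \<omega>)\<^sup>2 \<partial>M"
  have q: "0 \<le> s\<^sup>2 * ?a - 2 * s * t * ?b + t\<^sup>2 * ?c" for s t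
  proof -
    have "0 \<le> (\<integral>\<omega>. (s * f \<omega> - t * g \<omega>)\<^sup>2 \<partial>M)" by (intro integral_nonneg_AE) simp
    also have "\<dots> = (\<integral>\<omega>. s\<^sup>2 * (f \<omega>)\<^sup>2 - 2 * s * t * (f \<omega> * g \<omega>) + t\<^sup>2 * (g \<omega>)\<^sup>2 \<partial>M)"
      by (simp add: power2_eq_square algebra_simps)
    also have "\<dots> = s\<^sup>2 * ?a - 2 * s * t * ?b + t\<^sup>2 * ?c"
      using assms by simp
    finally show ?thesis .
  qed
  have a: "0 \<le> ?a" "0 \<le> ?c" by (auto intro!: integral_nonneg_AE)
  show ?thesis
  proof (cases "?a = 0 \<and> ?c = 0")
    case True
    \<comment> \<open>The quadratic form at (1, 1) and (1, -1) bounds the mixed integral from both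
      sides.\<close>
    then have "?b = 0" using q[of 1 1] q[of 1 "-1"] by simp
    then show ?thesis using a by simp
  next
    case False
    show ?thesis
    proof (cases "?a = 0")
      case True
      \<comment> \<open>The choice s = c, t = b makes the form factor as c (a c - b^2); in the other
        case the roles are exchanged.\<close>
      have "0 \<le> ?c * (?a * ?c - ?b\<^sup>2)" using q[of ?c ?b] by (simp add: power2_eq_square algebra_simps)
      then show ?thesis using False True a by (simp add: zero_le_mult_iff mult_le_0_iff)
    next
      case nz: False
      have "0 \<le> ?a * (?a * ?c - ?b\<^sup>2)" using q[of ?b ?a] by (simp add: power2_eq_square algebra_simps)
      then show ?thesis using nz a by (simp add: zero_le_mult_iff)
    qed
  qed
qed

section \<open>Product measures and independent pairs\<close>

lemma pair_integral_mult:
  fixes f :: "'a \<Rightarrow> real" and g :: "'b \<Rightarrow> real"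
  assumes "prob_space M" "prob_space N" "integrable M f" "integrable N g"
  shows integrable_pair_mult: "integrable (M \<Otimes>\<^sub>M N) (\<lambda>\<omega>. f (fst \<omega>) * g (snd \<omega>))"
    and integral_pair_mult: "(\<integral>\<omega>. f (fst \<omega>) * g (snd \<omega>) \<partial>(M \<Otimes>\<^sub>M N)) = (\<integral>x. f x \<partial>M) * (\<integral>y. g y \<partial>N)"
proof -
  interpret pair_sigma_finite M N
    by (rule pair_sigma_finite.intro; rule prob_space_imp_sigma_finite; rule assms)
  note [measurable] = borel_measurable_integrable[OF assms(3)] borel_measurable_integrable[OF assms(4)]
  show int: "integrable (M \<Otimes>\<^sub>M N) (\<lambda>\<omega>. f (fst \<omega>) * g (snd \<omega>))"
  proof (rule Fubini_integrable)
    have "integrable M (\<lambda>x. \<bar>f x\<bar> * (\<integral>y. \<bar>g y\<bar> \<partial>N))"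
      using assms(3) by (intro integrable_mult_left integrable_abs)
    then show "integrable M (\<lambda>x. \<integral>y. norm (f (fst (x, y)) * g (snd (x, y))) \<partial>N)"
      by (simp only: fst_conv snd_conv real_norm_def abs_mult integral_mult_right_zero)
    show "AE x in M. integrable N (\<lambda>y. f (fst (x, y)) * g (snd (x, y)))"
      using assms(4) by (intro AE_I2) (simp only: fst_conv snd_conv integrable_mult_right)
  qed measurable
  show "(\<integral>\<omega>. f (fst \<omega>) * g (snd \<omega>) \<partial>(M \<Otimes>\<^sub>M N)) = (\<integral>x. f x \<partial>M) * (\<integral>y. g y \<partial>N)"
    using integral_fst'[OF int] by simp
qed

text \<open>A pmf carries the discrete sigma-algebra, a product measure a priori only the one
  generated by rectangles. The identity map is measurable from the former to the latter, and it
  carries the product formula over to \<open>pair_pmf\<close>.\<close>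

lemma distr_pair_pmf:
  "distr (measure_pmf (pair_pmf A B)) (measure_pmf A \<Otimes>\<^sub>M measure_pmf B) (\<lambda>x. x)
    = measure_pmf A \<Otimes>\<^sub>M measure_pmf B"
proof (rule pair_measure_eqI[symmetric])
  fix X Y
  have "emeasure (distr (measure_pmf (pair_pmf A B)) (measure_pmf A \<Otimes>\<^sub>M measure_pmf B) (\<lambda>x. x)) (X \<times> Y)
      = (\<integral>\<^sup>+x. indicator (X \<times> Y) x \<partial>pair_pmf A B)"
    by (subst emeasure_distr) (auto simp: space_pair_measure)
  also have "\<dots> = (\<integral>\<^sup>+a. \<integral>\<^sup>+b. indicator X a * indicator Y b \<partial>B \<partial>A)"
    by (simp add: nn_integral_pair_pmf' indicator_times)
  also have "\<dots> = emeasure A X * emeasure B Y"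
    by (simp add: nn_integral_cmult nn_integral_multc)
  finally show "emeasure A X * emeasure B Y
      = emeasure (distr (measure_pmf (pair_pmf A B)) (measure_pmf A \<Otimes>\<^sub>M measure_pmf B) (\<lambda>x. x)) (X \<times> Y)" ..
qed (simp_all add: measure_pmf.sigma_finite_measure_axioms)

lemma pair_pmf_integral_mult:
  fixes f :: "'a \<Rightarrow> real" and g :: "'b \<Rightarrow> real"
  assumes "integrable (measure_pmf A) f" "integrable (measure_pmf B) g"
  shows integrable_pair_pmf_mult: "integrable (measure_pmf (pair_pmf A B)) (\<lambda>\<omega>. f (fst \<omega>) * g (snd \<omega>))"
    and integral_pair_pmf_mult: "(\<integral>\<omega>. f (fst \<omega>) * g (snd \<omega>) \<partial>measure_pmf (pair_pmf A B))
      = (\<integral>x. f x \<partial>measure_pmf A) * (\<integral>y. g y \<partial>measure_pmf B)"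
proof -
  note int = pair_integral_mult[OF measure_pmf.prob_space_axioms measure_pmf.prob_space_axioms assms]
  have m: "(\<lambda>x. x) \<in> measure_pmf (pair_pmf A B) \<rightarrow>\<^sub>M measure_pmf A \<Otimes>\<^sub>M measure_pmf B"
    by (simp add: measurable_def space_pair_measure)
  have b: "(\<lambda>\<omega>. f (fst \<omega>) * g (snd \<omega>)) \<in> borel_measurable (measure_pmf A \<Otimes>\<^sub>M measure_pmf B)"
    using int(1) by auto
  show "integrable (measure_pmf (pair_pmf A B)) (\<lambda>\<omega>. f (fst \<omega>) * g (snd \<omega>))"
    using int(1) integrable_distr[OF m, of "\<lambda>\<omega>. f (fst \<omega>) * g (snd \<omega>)"] by (simp add: distr_pair_pmf)
  show "(\<integral>\<omega>. f (fst \<omega>) * g (snd \<omega>) \<partial>measure_pmf (pair_pmf A B))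
      = (\<integral>x. f x \<partial>measure_pmf A) * (\<integral>y. g y \<partial>measure_pmf B)"
    using int(2) integral_distr[OF m b] by (simp add: distr_pair_pmf)
qed

lemma all_moments_fst_pair:
  assumes "prob_space M" "prob_space N" "all_moments M f"
  shows "all_moments (M \<Otimes>\<^sub>M N) (\<lambda>\<omega>. f (fst \<omega>))"
proof -
  have [measurable]: "f \<in> borel_measurable M" using assms by (simp add: all_moments_def)
  have "integrable (M \<Otimes>\<^sub>M N) (\<lambda>\<omega>. \<bar>f (fst \<omega>)\<bar> ^ k * 1)" for k
    by (rule integrable_pair_mult[where g = "\<lambda>_. 1"])
       (use assms all_moments_const[of _ 1] in \<open>auto simp: all_moments_def dest: all_moments_integrable\<close>)
  then show ?thesis by (simp add: all_moments_def)
qed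

lemma all_moments_snd_pair:
  assumes "prob_space M" "prob_space N" "all_moments N f"
  shows "all_moments (M \<Otimes>\<^sub>M N) (\<lambda>\<omega>. f (snd \<omega>))"
proof -
  have [measurable]: "f \<in> borel_measurable N" using assms by (simp add: all_moments_def)
  have "integrable (M \<Otimes>\<^sub>M N) (\<lambda>\<omega>. 1 * \<bar>f (snd \<omega>)\<bar> ^ k)" for k
    by (rule integrable_pair_mult[where f = "\<lambda>_. 1"])
       (use assms all_moments_const[of _ 1] in \<open>auto simp: all_moments_def dest: all_moments_integrable\<close>)
  then show ?thesis by (simp add: all_moments_def)
qed

lemma all_moments_coordinate_gauss:
  assumes "i < n"
  shows "all_moments (gauss n) (\<lambda>z. z i)"
proof -
  have pw: "integrable (gauss n) (\<lambda>z. z i ^ k)" for k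
  proof -
    have "(\<Prod>j<n. poly (if j = i then monom 1 k else 1) (z j)) = z i ^ k" for z :: "nat \<Rightarrow> real"
      using assms by (subst prod.remove[of _ i]) (auto simp: poly_monom intro!: prod.neutral)
    then show ?thesis
      using integrable_gauss_prod_poly[of n "\<lambda>j. if j = i then monom 1 k else 1"] by presburger
  qed
  have [measurable]: "(\<lambda>z. z i) \<in> borel_measurable (gauss n)"
    using borel_measurable_integrable[OF pw[of 1]] by simp
  show ?thesis
    unfolding all_moments_def
  proof (intro conjI allI)
    fix k
    show "integrable (gauss n) (\<lambda>z. \<bar>z i\<bar> ^ k)"
      using integrable_abs[OF pw[of k]] by (simp add: power_abs)
  qed measurable
qed

subsection \<open>Low-degree correlation and cumulants\<close>

lemma gam_eq: "gam n P = measure_pmf P \<Otimes>\<^sub>M gauss n"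
  by (simp add: gam_def gauss_def)

lemma prob_space_gam: "prob_space (gam n P)"
proof -
  interpret pair_prob_space "measure_pmf P" "gauss n"
    by (intro pair_prob_space.intro pair_sigma_finite.intro prob_space_imp_sigma_finite
        measure_pmf.prob_space_axioms prob_space_gauss)
  show ?thesis unfolding gam_eq by unfold_locales
qed

lemma observation_eq: "observation snr \<omega> i = sqrt snr * fst \<omega> i + snd \<omega> i"
  by (simp add: observation_def case_prod_beta)

definition mom :: "(nat \<Rightarrow> real) pmf \<Rightarrow> (nat \<times> nat) set \<Rightarrow> real" where
  "mom P L = (\<integral>x. lmon x L \<partial>measure_pmf P)"

definition coordinate_moments :: "nat \<Rightarrow> (nat \<Rightarrow> real) pmf \<Rightarrow> bool" where
  "coordinate_moments n P \<longleftrightarrow> (\<forall>i<n. all_moments (measure_pmf P) (\<lambda>x. x i))"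

lemma all_moments_lmon_prior:
  "coordinate_moments n P \<Longrightarrow> labels n L \<Longrightarrow> all_moments (measure_pmf P) (\<lambda>x. lmon x L)"
  unfolding lmon_def
  by (intro all_moments_prod measure_pmf.prob_space_axioms) (auto simp: coordinate_moments_def labels_def)

lemma all_moments_lmon_gauss: "labels n L \<Longrightarrow> all_moments (gauss n) (\<lambda>z. lmon z L)"
  unfolding lmon_def
  by (intro all_moments_prod prob_space_gauss all_moments_coordinate_gauss) (auto simp: labels_def)

lemma all_moments_hermite_sum: "all_moments (gauss n) (hermite_sum n D w)"
  unfolding hermite_sum_def poly_altdef
  by (intro all_moments_sum all_moments_mult all_moments_prod all_moments_const all_moments_power
      prob_space_gauss all_moments_coordinate_gauss) simp

lemma cnt_insert:
  assumes "finite A" "j \<notin> A"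
  shows "cnt (insert j A) = (cnt A)(fst j := Suc (cnt A (fst j)))"
proof
  fix i
  obtain a b where j: "j = (a, b)" by (cases j)
  have "{k. (i, k) \<in> insert j A} = (if i = a then insert b {k. (i, k) \<in> A} else {k. (i, k) \<in> A})"
    using j by auto
  then show "cnt (insert j A) i = ((cnt A)(fst j := Suc (cnt A (fst j)))) i"
    using assms finite_fibre[OF assms(1), of i] j by (auto simp: cnt_def)
qed

section \<open>The moment-cumulant recursion for the prior\<close>

lemma mom_empty: "mom P {} = 1"
  by (simp add: mom_def lmon_def)

text \<open>The recursion rooted at the fresh label \<open>j\<close>: sets containing the root
  correspond to subsets of \<open>L\<close>. The root will be the factor X_i of the
  correlation.\<close>

lemma mom_insert:
  assumes L: "labels n L" and j: "j \<notin> L" "fst j < n"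
  shows "mom P (insert j L) =
    (\<Sum>A\<in>Pow L. cumulant n P ((cnt A)(fst j := Suc (cnt A (fst j)))) * mom P (L - A))"
proof -
  let ?\<kappa> = "\<lambda>B. joint_cumulant (measure_pmf P) B (\<lambda>(i, k) x. x i)"
  have lab: "labels n (insert j L)" using L j by (auto simp: labels_def)
  have m: "mom P B = (\<integral>x. (\<Prod>j\<in>B. (\<lambda>(i, k) x. x i) j x) \<partial>measure_pmf P)" for B
    unfolding mom_def lmon_def by (simp add: case_prod_beta)
  have "mom P (insert j L) = (\<Sum>B | B \<subseteq> insert j L \<and> j \<in> B. ?\<kappa> B * mom P (insert j L - B))"
    by (rule moment_eq_sum_cumulants)
       (use labels_finite[OF L] in \<open>auto simp: joint_cumulant_def m\<close>)
  also have "\<dots> = (\<Sum>A\<in>Pow L. ?\<kappa> (insert j A) * mom P (L - A))"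
  proof (rule sum.reindex_bij_witness[where i = "insert j" and j = "\<lambda>B. B - {j}"], goal_cases)
    case (5 B)
    then have "insert j L - B = L - (B - {j})" "insert j (B - {j}) = B" using j by auto
    then show ?case by simp
  qed (use j in auto)
  also have "\<dots> = (\<Sum>A\<in>Pow L. cumulant n P ((cnt A)(fst j := Suc (cnt A (fst j)))) * mom P (L - A))"
  proof (intro sum.cong refl)
    fix A assume A: "A \<in> Pow L"
    have "?\<kappa> (insert j A) = cumulant n P (cnt (insert j A))"
      using lab A by (intro joint_cumulant_labels labels_subset[OF lab]) auto
    then show "?\<kappa> (insert j A) * mom P (L - A)
        = cumulant n P ((cnt A)(fst j := Suc (cnt A (fst j)))) * mom P (L - A)"
      using A j finite_subset[OF _ labels_finite[OF L], of A] by (subst (asm) cnt_insert) auto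
  qed
  finally show ?thesis .
qed

definition cumulant_weight :: "nat \<Rightarrow> (nat \<Rightarrow> real) pmf \<Rightarrow> real \<Rightarrow> nat \<Rightarrow> (nat \<Rightarrow> nat) \<Rightarrow> real" where
  "cumulant_weight n P snr i \<alpha> = sqrt snr ^ (\<Sum>k<n. \<alpha> k) * cumulant n P (\<alpha>(i := Suc (\<alpha> i)))"

section \<open>From the observation to the noise\<close>

lemma lmon_observation:
  assumes J: "finite J"
  shows "lmon (observation snr \<omega>) J
    = (\<Sum>B\<in>Pow J. sqrt snr ^ card B * (lmon (fst \<omega>) B * lmon (snd \<omega>) (J - B)))"
  unfolding lmon_def observation_eq prod_add[OF J]
  by (simp add: prod.distrib mult.assoc)

lemma all_moments_lmon_observation:
  assumes P: "coordinate_moments n P" and J: "labels n J"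
  shows "all_moments (gam n P) (\<lambda>\<omega>. lmon (observation snr \<omega>) J)"
  unfolding lmon_observation[OF labels_finite[OF J]] gam_eq
  by (intro all_moments_sum all_moments_mult all_moments_const prob_space_gam[unfolded gam_eq]
      all_moments_fst_pair[of _ _ "\<lambda>x. lmon x _"] all_moments_snd_pair[of _ _ "\<lambda>x. lmon x _"]
      measure_pmf.prob_space_axioms prob_space_gauss
      all_moments_lmon_prior[OF P] all_moments_lmon_gauss labels_subset[OF J]) auto

text \<open>Both sides run over ordered pairs of disjoint subsets of \<open>J\<close>, given on the
  left by one member and the union, on the right by the two members.\<close>

lemma sum_Pow_Diff_swap:
  assumes "finite J"
  shows "(\<Sum>B\<in>Pow J. \<Sum>A\<in>Pow B. f A (B - A)) = (\<Sum>B\<in>Pow J. \<Sum>A\<in>Pow (J - B). (f A B :: real))"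
proof -
  have fin: "finite (Pow B)" if "B \<subseteq> J" for B using finite_subset[OF that assms] by simp
  have "(\<Sum>B\<in>Pow J. \<Sum>A\<in>Pow B. f A (B - A)) = (\<Sum>(B, A)\<in>Sigma (Pow J) Pow. f A (B - A))"
    using assms fin by (subst sum.Sigma) auto
  also have "\<dots> = (\<Sum>(B, A)\<in>Sigma (Pow J) (\<lambda>B. Pow (J - B)). f A B)"
    by (rule sum.reindex_bij_witness[where i = "\<lambda>(B, A). (A \<union> B, A)" and j = "\<lambda>(B, A). (B - A, A)"]) auto
  also have "\<dots> = (\<Sum>B\<in>Pow J. \<Sum>A\<in>Pow (J - B). f A B)"
    using assms by (subst sum.Sigma) (auto intro: fin)
  finally show ?thesis .
qed

text \<open>Expanding the observation splits \<open>J\<close> into signal labels and noise labels,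
  and the recursion splits the signal labels further into those joined with X_i in a cumulant and
  the rest. Moving the cumulant labels over to the noise side produces exactly the pairing of the
  noise monomial with the Hermite sum.\<close>

lemma integral_lmon_observation_signal:
  assumes P: "coordinate_moments n P" and J: "labels n J" and D: "card J \<le> D" and i: "i < n"
  shows "(\<integral>\<omega>. lmon (observation snr \<omega>) J * fst \<omega> i \<partial>gam n P)
    = (\<integral>\<omega>. hermite_sum n D (cumulant_weight n P snr i) (snd \<omega>) * lmon (observation snr \<omega>) J \<partial>gam n P)"
proof -
  let ?s = "sqrt snr" and ?W = "hermite_sum n D (cumulant_weight n P snr i)"
  let ?\<kappa> = "\<lambda>A. cumulant n P ((cnt A)(i := Suc (cnt A i)))"
  note fin = labels_finite[OF J]
  note sub = labels_subset[OF J]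
  have "finite {k. (i, k) \<in> J}" by (rule finite_fibre[OF fin])
  \<comment> \<open>A label of row \<open>i\<close> outside \<open>J\<close> represents the factor
    X_i; any free one will do, since only counts matter.\<close>
  then obtain k where k: "(i, k) \<notin> J"
    using ex_new_if_finite[OF infinite_UNIV_nat] by blast
  let ?j = "(i, k)"
  have ps: "prob_space (measure_pmf P)" by (rule measure_pmf.prob_space_axioms)
  have pg: "prob_space (gauss n)" by (rule prob_space_gauss)
  have insj: "labels n (insert ?j B)" if "B \<subseteq> J" for B
    using sub[OF that] i by (auto simp: labels_def)
  have split: "lmon x B * x i = lmon x (insert ?j B)" if "B \<subseteq> J" for x B
  proof -
    have "(i, k) \<notin> B" "finite B" using that k finite_subset[OF that fin] by auto
    then show ?thesis by (simp add: lmon_def)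
  qed
  have L1: "lmon (observation snr \<omega>) J * fst \<omega> i
      = (\<Sum>B\<in>Pow J. ?s ^ card B * (lmon (fst \<omega>) (insert ?j B) * lmon (snd \<omega>) (J - B)))" for \<omega>
    unfolding lmon_observation[OF fin] sum_distrib_right
  proof (intro sum.cong refl)
    fix B assume "B \<in> Pow J"
    then have e: "lmon (fst \<omega>) (insert ?j B) = lmon (fst \<omega>) B * fst \<omega> i"
      using split[of B "fst \<omega>"] by simp
    show "?s ^ card B * (lmon (fst \<omega>) B * lmon (snd \<omega>) (J - B)) * fst \<omega> i
        = ?s ^ card B * (lmon (fst \<omega>) (insert ?j B) * lmon (snd \<omega>) (J - B))"
      unfolding e by simp
  qed
  have "(\<integral>\<omega>. lmon (observation snr \<omega>) J * fst \<omega> i \<partial>gam n P)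
      = (\<Sum>B\<in>Pow J. ?s ^ card B * (mom P (insert ?j B) * gmom n (J - B)))"
  proof -
    have int: "integrable (measure_pmf P) (\<lambda>x. lmon x (insert ?j B))" "integrable (gauss n) (\<lambda>z. lmon z (J - B))"
      if "B \<in> Pow J" for B
      using that insj[of B] sub[of "J - B"]
      by (auto intro!: all_moments_integrable all_moments_lmon_prior[OF P] all_moments_lmon_gauss)
    show ?thesis
      unfolding L1 gam_eq mom_def gmom_def
      by (subst Bochner_Integration.integral_sum)
         (auto intro!: sum.cong integrable_mult_right integrable_pair_mult[OF ps pg] int
           simp: integral_pair_mult[OF ps pg int])
  qed
  also have "\<dots> = (\<Sum>B\<in>Pow J. \<Sum>A\<in>Pow B. ?s ^ card B * (?\<kappa> A * mom P (B - A) * gmom n (J - B)))"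
  proof (intro sum.cong refl)
    fix B assume "B \<in> Pow J"
    then have "mom P (insert ?j B) = (\<Sum>A\<in>Pow B. ?\<kappa> A * mom P (B - A))"
      using mom_insert[OF sub, of B ?j P] k i by auto
    then show "?s ^ card B * (mom P (insert ?j B) * gmom n (J - B))
        = (\<Sum>A\<in>Pow B. ?s ^ card B * (?\<kappa> A * mom P (B - A) * gmom n (J - B)))"
      by (simp add: sum_distrib_left sum_distrib_right)
  qed
  \<comment> \<open>Everything is rewritten in terms of \<open>A\<close> and \<open>B - A\<close>,
    the form in which the change of summation applies.\<close>
  also have "\<dots> = (\<Sum>B\<in>Pow J. \<Sum>A\<in>Pow B. ?s ^ (card A + card (B - A)) * (?\<kappa> A * mom P (B - A) * gmom n (J - (A \<union> (B - A)))))"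
  proof (intro sum.cong refl)
    fix B A assume "B \<in> Pow J" "A \<in> Pow B"
    then have "card B = card A + card (B - A)" "A \<union> (B - A) = B"
      using finite_subset[OF _ fin, of B] finite_subset[of A B]
      by (auto simp: card_Diff_subset card_mono)
    then show "?s ^ card B * (?\<kappa> A * mom P (B - A) * gmom n (J - B))
        = ?s ^ (card A + card (B - A)) * (?\<kappa> A * mom P (B - A) * gmom n (J - (A \<union> (B - A))))"
      by simp
  qed
  also have "\<dots> = (\<Sum>B\<in>Pow J. \<Sum>A\<in>Pow (J - B). ?s ^ (card A + card B) * (?\<kappa> A * mom P B * gmom n (J - (A \<union> B))))"
    using sum_Pow_Diff_swap[OF fin, of "\<lambda>A C. ?s ^ (card A + card C) * (?\<kappa> A * mom P C * gmom n (J - (A \<union> C)))"] .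
  also have "\<dots> = (\<Sum>B\<in>Pow J. ?s ^ card B * (mom P B * (\<Sum>A\<in>Pow (J - B). cumulant_weight n P snr i (cnt A) * gmom n (J - B - A))))"
  proof (intro sum.cong refl)
    fix B assume B: "B \<in> Pow J"
    have "cumulant_weight n P snr i (cnt A) = ?s ^ card A * ?\<kappa> A" if "A \<in> Pow (J - B)" for A
    proof -
      have "A \<subseteq> J" using that by auto
      then show ?thesis using sum_cnt[OF sub, of A] by (simp add: cumulant_weight_def)
    qed
    moreover have "J - (A \<union> B) = J - B - A" for A by auto
    ultimately show "(\<Sum>A\<in>Pow (J - B). ?s ^ (card A + card B) * (?\<kappa> A * mom P B * gmom n (J - (A \<union> B))))
        = ?s ^ card B * (mom P B * (\<Sum>A\<in>Pow (J - B). cumulant_weight n P snr i (cnt A) * gmom n (J - B - A)))"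
      by (simp add: sum_distrib_left power_add mult_ac)
  qed
  also have "\<dots> = (\<Sum>B\<in>Pow J. ?s ^ card B * (mom P B * (\<integral>z. ?W z * lmon z (J - B) \<partial>gauss n)))"
  proof (intro sum.cong refl)
    fix B assume "B \<in> Pow J"
    have "card (J - B) \<le> D" using D card_mono[OF fin, of "J - B"] by auto
    then show "?s ^ card B * (mom P B * (\<Sum>A\<in>Pow (J - B). cumulant_weight n P snr i (cnt A) * gmom n (J - B - A)))
        = ?s ^ card B * (mom P B * (\<integral>z. ?W z * lmon z (J - B) \<partial>gauss n))"
      by (subst integral_hermite_sum_lmon) (auto intro: sub)
  qed
  also have "\<dots> = (\<integral>\<omega>. ?W (snd \<omega>) * lmon (observation snr \<omega>) J \<partial>gam n P)"
  proof -
    have R1: "?W (snd \<omega>) * lmon (observation snr \<omega>) J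
        = (\<Sum>B\<in>Pow J. ?s ^ card B * (lmon (fst \<omega>) B * (?W (snd \<omega>) * lmon (snd \<omega>) (J - B))))" for \<omega>
      unfolding lmon_observation[OF fin] sum_distrib_left
      by (intro sum.cong refl) simp
    have int: "integrable (measure_pmf P) (\<lambda>x. lmon x B)" "integrable (gauss n) (\<lambda>z. ?W z * lmon z (J - B))"
      if "B \<in> Pow J" for B
      using that by (auto intro!: all_moments_integrable all_moments_lmon_prior[OF P] all_moments_mult
          all_moments_hermite_sum all_moments_lmon_gauss sub)
    show ?thesis
      unfolding R1 gam_eq mom_def
      by (subst Bochner_Integration.integral_sum)
         (auto intro!: sum.cong integrable_mult_right integrable_pair_mult[OF ps pg, where g = "\<lambda>z. ?W z * lmon z (J - _)"] int
           simp: integral_pair_mult[OF ps pg int])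
  qed
  finally show ?thesis .
qed

section \<open>Cauchy-Schwarz and the supremum over polynomials\<close>

lemma polys_leE:
  assumes "g \<in> polys_le n D"
  obtains c where "g = (\<lambda>y. \<Sum>\<alpha>\<in>multi_indices n D. c \<alpha> * lmon y (copies n \<alpha>))"
proof -
  obtain c where g: "g = (\<lambda>y. \<Sum>\<alpha>\<in>multi_indices n D. c \<alpha> * (\<Prod>i<n. y i ^ \<alpha> i))"
    using assms by (auto simp: polys_le_def)
  have "(\<Prod>i<n. y i ^ \<alpha> i) = lmon y (copies n \<alpha>)" if "\<alpha> \<in> multi_indices n D" for y and \<alpha>
    using that unfolding lmon_def
    by (subst prod_labels[OF labels_copies]) (simp add: cnt_copies multi_indices_def)
  then show ?thesis using that[of c] by (simp add: g)
qed

lemma card_copies: "card (copies n \<alpha>) = (\<Sum>i<n. \<alpha> i)"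
  by (simp add: copies_def)

text \<open>By linearity the identity for monomials holds for \<open>g\<close>. The normalisation
  removes one factor of Cauchy-Schwarz, and the other depends on the noise only, hence is an
  explicit Gaussian integral.\<close>

lemma correlation_polynomial_le:
  assumes P: "coordinate_moments n P" and i: "i < n" and snr: "snr \<ge> 0"
    and g: "g \<in> polys_le n D" and norm: "(\<integral>\<omega>. (g (observation snr \<omega>))\<^sup>2 \<partial>gam n P) = 1"
  shows "(\<integral>\<omega>. g (observation snr \<omega>) * fst \<omega> i \<partial>gam n P)\<^sup>2
    \<le> (\<Sum>\<alpha>\<in>multi_indices n D. snr ^ (\<Sum>k<n. \<alpha> k) * (cumulant n P (\<alpha>(i := Suc (\<alpha> i))))\<^sup>2 / (\<Prod>k<n. fact (\<alpha> k)))"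
proof -
  let ?W = "hermite_sum n D (cumulant_weight n P snr i)"
  obtain c where c: "g = (\<lambda>y. \<Sum>\<alpha>\<in>multi_indices n D. c \<alpha> * lmon y (copies n \<alpha>))"
    using polys_leE[OF g] .
  have ps: "prob_space (measure_pmf P)" by (rule measure_pmf.prob_space_axioms)
  note pg = prob_space_gauss[of n]
  have Wm: "all_moments (gam n P) (\<lambda>\<omega>. ?W (snd \<omega>))"
    unfolding gam_eq by (intro all_moments_snd_pair ps pg all_moments_hermite_sum)
  have Xm: "all_moments (gam n P) (\<lambda>\<omega>. fst \<omega> i)"
    unfolding gam_eq using P i by (intro all_moments_fst_pair[where f = "\<lambda>x. x i"] ps pg) (simp add: coordinate_moments_def)
  have om: "all_moments (gam n P) (\<lambda>\<omega>. lmon (observation snr \<omega>) (copies n \<alpha>))" for \<alpha>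
    by (intro all_moments_lmon_observation P labels_copies)
  have gm: "all_moments (gam n P) (\<lambda>\<omega>. g (observation snr \<omega>))"
    unfolding c by (intro all_moments_sum all_moments_mult all_moments_const prob_space_gam om)
  have "(\<integral>\<omega>. g (observation snr \<omega>) * fst \<omega> i \<partial>gam n P)
      = (\<Sum>\<alpha>\<in>multi_indices n D. c \<alpha> * (\<integral>\<omega>. lmon (observation snr \<omega>) (copies n \<alpha>) * fst \<omega> i \<partial>gam n P))"
    unfolding c sum_distrib_right mult.assoc
    by (subst Bochner_Integration.integral_sum) (auto intro!: integrable_mult_right all_moments_integrable all_moments_mult om Xm)
  also have "\<dots> = (\<Sum>\<alpha>\<in>multi_indices n D. c \<alpha> * (\<integral>\<omega>. ?W (snd \<omega>) * lmon (observation snr \<omega>) (copies n \<alpha>) \<partial>gam n P))"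
    by (intro sum.cong refl arg_cong2[of _ _ _ _ "(*)"] integral_lmon_observation_signal P labels_copies i)
       (simp add: card_copies multi_indices_def)
  also have "\<dots> = (\<integral>\<omega>. ?W (snd \<omega>) * g (observation snr \<omega>) \<partial>gam n P)"
    unfolding c sum_distrib_left mult.left_commute[of _ "c _"]
    by (subst Bochner_Integration.integral_sum) (auto intro!: integrable_mult_right all_moments_integrable all_moments_mult om Wm)
  finally have "(\<integral>\<omega>. g (observation snr \<omega>) * fst \<omega> i \<partial>gam n P)\<^sup>2
      \<le> (\<integral>\<omega>. (?W (snd \<omega>))\<^sup>2 \<partial>gam n P) * (\<integral>\<omega>. (g (observation snr \<omega>))\<^sup>2 \<partial>gam n P)"
    using Cauchy_Schwarz_integral[of "gam n P" "\<lambda>\<omega>. ?W (snd \<omega>)" "\<lambda>\<omega>. g (observation snr \<omega>)"]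
      all_moments_integrable[OF all_moments_power[OF prob_space_gam Wm]]
      all_moments_integrable[OF all_moments_power[OF prob_space_gam gm]]
      all_moments_integrable[OF all_moments_mult[OF Wm gm]] by simp
  also have "\<dots> = (\<integral>\<omega>. (?W (snd \<omega>))\<^sup>2 \<partial>gam n P)" using norm by simp
  also have "\<dots> = (\<integral>z. (?W z)\<^sup>2 \<partial>gauss n)"
    using integral_pair_mult[OF ps pg, where f = "\<lambda>_. 1" and g = "\<lambda>z. (?W z)\<^sup>2"]
      all_moments_integrable[OF all_moments_power[OF pg all_moments_hermite_sum]]
    by (simp add: gam_eq)
  also have "\<dots> = (\<Sum>\<alpha>\<in>multi_indices n D. snr ^ (\<Sum>k<n. \<alpha> k) * (cumulant n P (\<alpha>(i := Suc (\<alpha> i))))\<^sup>2 / (\<Prod>k<n. fact (\<alpha> k)))"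
    unfolding integral_hermite_sum_square
    by (intro sum.cong refl) (simp add: cumulant_weight_def power_mult_distrib power_mult[symmetric] mult.commute[of _ 2] power_mult[of _ 2] snr)
  finally show ?thesis .
qed

lemma Corr_le_sum_cumulants:
  assumes P: "coordinate_moments n P" and snr: "snr \<ge> 0"
  shows "(Corr_le n P D snr)\<^sup>2 \<le> (\<Sum>i<n. \<Sum>\<alpha>\<in>multi_indices n D.
    snr ^ (\<Sum>k<n. \<alpha> k) * (cumulant n P (\<alpha>(i := Suc (\<alpha> i))))\<^sup>2 / (\<Prod>k<n. fact (\<alpha> k)))"
proof -
  let ?G = "{g \<in> polys_le n D. (\<integral>\<omega>. (g (observation snr \<omega>))\<^sup>2 \<partial>gam n P) = 1}"
  let ?v = "\<lambda>i g. (\<integral>\<omega>. g (observation snr \<omega>) * fst \<omega> i \<partial>gam n P)\<^sup>2"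
  let ?S = "\<lambda>i. \<Sum>\<alpha>\<in>multi_indices n D. snr ^ (\<Sum>k<n. \<alpha> k) * (cumulant n P (\<alpha>(i := Suc (\<alpha> i))))\<^sup>2 / (\<Prod>k<n. fact (\<alpha> k))"
  \<comment> \<open>The constant polynomial is admissible. Together with the uniform bound this
    makes each supremum a genuine one, and nonnegative, so that squaring undoes the square
    root.\<close>
  have one: "(\<lambda>_. 1) \<in> ?G"
  proof -
    have "(\<lambda>_. 1) = (\<lambda>y :: nat \<Rightarrow> real. \<Sum>\<alpha>\<in>multi_indices n D. (if \<alpha> = (\<lambda>_. 0) then 1 else 0) * (\<Prod>i<n. y i ^ \<alpha> i))"
    proof
      fix y :: "nat \<Rightarrow> real"
      have "(\<Sum>\<alpha>\<in>multi_indices n D. (if \<alpha> = (\<lambda>_. 0) then 1 else 0) * (\<Prod>i<n. y i ^ \<alpha> i))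
          = (\<Sum>\<alpha>\<in>{\<lambda>_. 0}. (\<Prod>i<n. y i ^ \<alpha> i))"
        by (rule sum.mono_neutral_cong_right) (auto simp: finite_multi_indices, auto simp: multi_indices_def)
      then show "1 = (\<Sum>\<alpha>\<in>multi_indices n D. (if \<alpha> = (\<lambda>_. 0) then 1 else 0) * (\<Prod>i<n. y i ^ \<alpha> i))" by simp
    qed
    then have "(\<lambda>_. 1) \<in> polys_le n D" 
      unfolding polys_le_def by (rule range_eqI[where x = "\<lambda>\<alpha>. if \<alpha> = (\<lambda>_. 0) then 1 else 0"])
    moreover have "measure (gam n P) (space (gam n P)) = 1"
      using prob_space.prob_space[OF prob_space_gam] .
    ultimately show ?thesis by simp
  qed
  have le: "?v i g \<le> ?S i" if "i < n" "g \<in> ?G" for i g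
    using correlation_polynomial_le[OF P that(1) snr] that(2) by auto
  have sup: "0 \<le> (SUP g\<in>?G. ?v i g) \<and> (SUP g\<in>?G. ?v i g) \<le> ?S i" if i: "i < n" for i
  proof
    show "(SUP g\<in>?G. ?v i g) \<le> ?S i"
      using one le[OF i] by (intro cSUP_least) auto
    have "0 \<le> ?v i (\<lambda>_. 1)" by simp
    also have "\<dots> \<le> (SUP g\<in>?G. ?v i g)"
      using one le[OF i] by (intro cSUP_upper bdd_aboveI2[where M = "?S i"]) auto
    finally show "0 \<le> (SUP g\<in>?G. ?v i g)" .
  qed
  have "(Corr_le n P D snr)\<^sup>2 = (\<Sum>i<n. SUP g\<in>?G. ?v i g)"
    unfolding Corr_le_def using sup by (intro real_sqrt_pow2 sum_nonneg) auto
  also have "\<dots> \<le> (\<Sum>i<n. ?S i)" using sup by (intro sum_mono) auto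
  finally show ?thesis .
qed

subsection \<open>The multinomial theorem\<close>

definition exact_indices :: "nat \<Rightarrow> nat \<Rightarrow> (nat \<Rightarrow> nat) set" where
  "exact_indices n d = {\<alpha>. (\<forall>i\<ge>n. \<alpha> i = 0) \<and> (\<Sum>i<n. \<alpha> i) = d}"

lemma exact_indices_subset: "d \<le> D \<Longrightarrow> exact_indices n d \<subseteq> multi_indices n D"
  by (auto simp: exact_indices_def multi_indices_def)

lemma finite_exact_indices: "finite (exact_indices n d)"
  using finite_subset[OF exact_indices_subset[OF order_refl] finite_multi_indices] .

lemma sum_multi_indices:
  "(\<Sum>\<alpha>\<in>multi_indices n D. f \<alpha>) = (\<Sum>d\<le>D. \<Sum>\<alpha>\<in>exact_indices n d. f \<alpha>)"
proof -
  have "(\<Sum>\<alpha>\<in>multi_indices n D. f \<alpha>)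
      = (\<Sum>d\<le>D. \<Sum>\<alpha>\<in>{\<alpha> \<in> multi_indices n D. (\<Sum>i<n. \<alpha> i) = d}. f \<alpha>)"
    by (rule sum.group[symmetric]) (auto simp: finite_multi_indices, auto simp: multi_indices_def)
  also have "\<dots> = (\<Sum>d\<le>D. \<Sum>\<alpha>\<in>exact_indices n d. f \<alpha>)"
    by (intro sum.cong refl) (auto simp: exact_indices_def multi_indices_def)
  finally show ?thesis .
qed

lemma exact_indices_Suc_sum:
  "(\<Sum>\<alpha>\<in>exact_indices (Suc n) d. f \<alpha>) = (\<Sum>k\<le>d. \<Sum>\<beta>\<in>exact_indices n (d - k). f (\<beta>(n := k)) :: real)"
proof -
  have "(\<Sum>\<alpha>\<in>exact_indices (Suc n) d. f \<alpha>)
      = (\<Sum>(k, \<beta>)\<in>(SIGMA k:{..d}. exact_indices n (d - k)). f (\<beta>(n := k)))"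
  proof (rule sum.reindex_bij_witness[where i = "\<lambda>(k, \<beta>). \<beta>(n := k)" and j = "\<lambda>\<alpha>. (\<alpha> n, \<alpha>(n := 0))"], goal_cases)
    case (2 \<alpha>)
    have "(\<Sum>i<n. (\<alpha>(n := 0)) i) = (\<Sum>i<n. \<alpha> i)" by (intro sum.cong) auto
    then show ?case using 2 by (auto simp: exact_indices_def)
  next
    case (3 p)
    then show ?case by (auto simp: exact_indices_def fun_eq_iff)
  next
    case (4 p)
    obtain k \<beta> where p: "p = (k, \<beta>)" by (cases p)
    have "(\<Sum>i<n. (\<beta>(n := k)) i) = (\<Sum>i<n. \<beta> i)" by (intro sum.cong) auto
    then show ?case using 4 p by (auto simp: exact_indices_def)
  qed auto
  also have "\<dots> = (\<Sum>k\<le>d. \<Sum>\<beta>\<in>exact_indices n (d - k). f (\<beta>(n := k)))"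
    by (subst sum.Sigma) (auto simp: finite_exact_indices)
  finally show ?thesis .
qed

text \<open>With factorials in place of multinomial coefficients, splitting off the last variable
  leaves a binomial sum.\<close>

lemma multinomial_theorem:
  fixes u :: "nat \<Rightarrow> real"
  shows "(\<Sum>\<alpha>\<in>exact_indices n d. (\<Prod>k<n. u k ^ \<alpha> k) / (\<Prod>k<n. fact (\<alpha> k))) = (\<Sum>k<n. u k) ^ d / fact d"
proof (induction n arbitrary: d)
  case 0
  have "exact_indices 0 d = (if d = 0 then {\<lambda>_. 0} else {})" by (auto simp: exact_indices_def)
  then show ?case by simp
next
  case (Suc n)
  let ?S = "\<Sum>k<n. u k"
  have p: "(\<Prod>i<n. u i ^ (\<beta>(n := k)) i) = (\<Prod>i<n. u i ^ \<beta> i)"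
    "(\<Prod>i<n. fact ((\<beta>(n := k)) i)) = (\<Prod>i<n. fact (\<beta> i) :: real)" for \<beta> k
    by (auto intro!: prod.cong)
  have "(\<Sum>\<alpha>\<in>exact_indices (Suc n) d. (\<Prod>k<Suc n. u k ^ \<alpha> k) / (\<Prod>k<Suc n. fact (\<alpha> k)))
      = (\<Sum>k\<le>d. u n ^ k / fact k * (\<Sum>\<beta>\<in>exact_indices n (d - k). (\<Prod>i<n. u i ^ \<beta> i) / (\<Prod>i<n. fact (\<beta> i))))"
    unfolding exact_indices_Suc_sum sum_distrib_left
    by (intro sum.cong refl) (simp add: p mult.commute)
  also have "\<dots> = (\<Sum>k\<le>d. of_nat (d choose k) * u n ^ k * ?S ^ (d - k)) / fact d"
    unfolding Suc.IH sum_divide_distrib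
    by (intro sum.cong refl) (simp add: binomial_fact)
  also have "\<dots> = (\<Sum>k<Suc n. u k) ^ d / fact d"
    by (simp add: binomial_ring[symmetric] add.commute)
  finally show ?case .
qed

lemma lmon_copies: "\<alpha> \<in> exact_indices n d \<Longrightarrow> lmon u (copies n \<alpha>) = (\<Prod>k<n. u k ^ \<alpha> k)"
  unfolding lmon_def by (subst prod_labels[OF labels_copies]) (simp add: cnt_copies exact_indices_def)

lemma sum_lmon_copies:
  "(\<Sum>\<alpha>\<in>exact_indices n d. lmon u (copies n \<alpha>) / (\<Prod>k<n. fact (\<alpha> k))) = (\<Sum>k<n. u k) ^ d / fact d"
  unfolding multinomial_theorem[symmetric] by (intro sum.cong refl) (simp add: lmon_copies)

subsection \<open>Nonnegative cumulants\<close>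

text \<open>The recursion writes a moment as a sum of products of cumulants of order at most
  \<open>D\<close> and moments of fewer labels, so induction on the number of labels
  applies.\<close>

lemma mom_nonneg:
  assumes \<kappa>: "\<And>\<alpha>. \<alpha> \<in> multi_indices n D \<Longrightarrow> cumulant n P \<alpha> \<ge> 0"
  shows "labels n L \<Longrightarrow> card L \<le> D \<Longrightarrow> mom P L \<ge> 0"
proof (induction "card L" arbitrary: L rule: less_induct)
  case less
  show ?case
  proof (cases "L = {}")
    case True
    then show ?thesis by (simp add: mom_empty)
  next
    case False
    then obtain j where j: "j \<in> L" by auto
    define L' where "L' = L - {j}"
    have L: "L = insert j L'" "j \<notin> L'" "L' \<subseteq> L" using j by (auto simp: L'_def)
    have fin: "finite L" using labels_finite[OF less.prems(1)] .
    have lab: "labels n L'" using labels_subset[OF less.prems(1) L(3)] .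
    have "mom P (insert j L') =
        (\<Sum>A\<in>Pow L'. cumulant n P ((cnt A)(fst j := Suc (cnt A (fst j)))) * mom P (L' - A))"
      using mom_insert[OF lab L(2)] less.prems(1) j by (auto simp: labels_def)
    also have "\<dots> \<ge> 0"
    proof (intro sum_nonneg mult_nonneg_nonneg)
      fix A assume A: "A \<in> Pow L'"
      have A': "finite A" "j \<notin> A" "insert j A \<subseteq> L" using A L fin finite_subset[of A L] by auto
      have "cnt (insert j A) \<in> multi_indices n D"
        using labels_subset[OF less.prems(1) A'(3)] card_mono[OF fin A'(3)] less.prems(2)
        by (intro cnt_multi_indices) auto
      then show "cumulant n P ((cnt A)(fst j := Suc (cnt A (fst j)))) \<ge> 0"
        using \<kappa> cnt_insert[OF A'(1,2)] by simp
      have "L' - A \<subset> L" using L j by auto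
      then have "card (L' - A) < card L" using fin psubset_card_mono by blast
      then show "mom P (L' - A) \<ge> 0"
        using less.hyps[of "L' - A"] less.prems labels_subset[OF lab, of "L' - A"] by auto
    qed
    finally show ?thesis using L by simp
  qed
qed

text \<open>All terms of the recursion are nonnegative, and the cumulant is the term
  \<open>A = L\<close>, where the remaining moment is 1. The inequality \<open>card L < D\<close> is
  strict because the root raises the order by one.\<close>

lemma cumulant_le_mom:
  assumes \<kappa>: "\<And>\<alpha>. \<alpha> \<in> multi_indices n D \<Longrightarrow> cumulant n P \<alpha> \<ge> 0"
    and L: "labels n L" "card L < D" and j: "j \<notin> L" "fst j < n"
  shows "0 \<le> cumulant n P ((cnt L)(fst j := Suc (cnt L (fst j))))"
    and "cumulant n P ((cnt L)(fst j := Suc (cnt L (fst j)))) \<le> mom P (insert j L)"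
proof -
  let ?\<kappa> = "\<lambda>A. cumulant n P ((cnt A)(fst j := Suc (cnt A (fst j))))"
  have fin: "finite L" using labels_finite[OF L(1)] .
  have lab: "labels n (insert j L)" using L j by (auto simp: labels_def)
  have nonneg: "?\<kappa> A \<ge> 0" if A: "A \<subseteq> L" for A
  proof -
    have A': "finite A" "j \<notin> A" "insert j A \<subseteq> insert j L" using A fin j finite_subset[of A L] by auto
    have "card (insert j A) \<le> D"
      using A' card_mono[OF fin A] L(2) by simp
    then have "cnt (insert j A) \<in> multi_indices n D"
      using labels_subset[OF lab A'(3)] by (intro cnt_multi_indices)
    then show ?thesis using \<kappa> cnt_insert[OF A'(1,2)] by simp
  qed
  then show "0 \<le> ?\<kappa> L" by simp
  have m: "mom P (L - A) \<ge> 0" if "A \<subseteq> L" for A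
    using mom_nonneg[OF \<kappa>, of D "L - A"] labels_subset[OF L(1), of "L - A"] card_mono[OF fin, of "L - A"] L(2)
    by auto
  have "?\<kappa> L = ?\<kappa> L * mom P (L - L)" by (simp add: mom_empty)
  also have "\<dots> \<le> (\<Sum>A\<in>Pow L. ?\<kappa> A * mom P (L - A))"
    by (rule member_le_sum) (use fin nonneg m in \<open>auto intro!: mult_nonneg_nonneg\<close>)
  also have "\<dots> = mom P (insert j L)" using mom_insert[OF L(1) j] by simp
  finally show "?\<kappa> L \<le> mom P (insert j L)" .
qed

text \<open>
  The cumulants of order \<open>D + 1\<close> need not be nonnegative, but they also enter a degree \<open>D\<close>
  correlation. The recursion expresses such a cumulant by \<open>2 ^ D\<close> products of moments and
  nonnegative cumulants.
\<close>

lemma cumulant_square_le: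
  assumes \<kappa>: "\<And>\<alpha>. \<alpha> \<in> multi_indices n D \<Longrightarrow> cumulant n P \<alpha> \<ge> 0"
    and L: "labels n L" "card L = D" and j: "j \<notin> L" "fst j < n"
  shows "(cumulant n P ((cnt L)(fst j := Suc (cnt L (fst j)))))\<^sup>2
    \<le> 2 ^ D * (\<Sum>A\<in>Pow L. (mom P (insert j A))\<^sup>2 * (mom P (L - A))\<^sup>2)"
proof -
  let ?\<kappa> = "\<lambda>A. cumulant n P ((cnt A)(fst j := Suc (cnt A (fst j))))"
  define t where "t A = (if A = L then mom P (insert j L) else - (?\<kappa> A * mom P (L - A)))" for A
  have fin: "finite L" using labels_finite[OF L(1)] .
  have P: "Pow L = insert L (Pow L - {L})" by auto
  have "mom P (insert j L) = ?\<kappa> L + (\<Sum>A\<in>Pow L - {L}. ?\<kappa> A * mom P (L - A))"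
    unfolding mom_insert[OF L(1) j] using fin by (subst P, subst sum.insert) (auto simp: mom_empty)
  moreover have "(\<Sum>A\<in>Pow L. t A) = mom P (insert j L) - (\<Sum>A\<in>Pow L - {L}. ?\<kappa> A * mom P (L - A))"
    using fin by (subst P, subst sum.insert) (auto simp: t_def sum_negf)
  ultimately have "(?\<kappa> L)\<^sup>2 = (\<Sum>A\<in>Pow L. t A)\<^sup>2" by simp
  also have "\<dots> \<le> (\<Sum>A\<in>Pow L. (t A)\<^sup>2) * card (Pow L)" by (rule sum_squared_le_sum_of_squares)
  also have "\<dots> = 2 ^ D * (\<Sum>A\<in>Pow L. (t A)\<^sup>2)" using L fin by (simp add: card_Pow)
  also have "\<dots> \<le> 2 ^ D * (\<Sum>A\<in>Pow L. (mom P (insert j A))\<^sup>2 * (mom P (L - A))\<^sup>2)"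
  proof (intro mult_left_mono sum_mono)
    fix A assume A: "A \<in> Pow L"
    show "(t A)\<^sup>2 \<le> (mom P (insert j A))\<^sup>2 * (mom P (L - A))\<^sup>2"
    proof (cases "A = L")
      case True
      then show ?thesis by (simp add: t_def mom_empty)
    next
      case False
      \<comment> \<open>A proper subset leaves room for the root: its cumulant has order at most
        \<open>D\<close> and is dominated by the moment.\<close>
      with A have AL: "A \<subset> L" by auto
      then have "card A < D" using psubset_card_mono[OF fin AL] L by simp
      then have "0 \<le> ?\<kappa> A" "?\<kappa> A \<le> mom P (insert j A)"
        using cumulant_le_mom[OF \<kappa>, of D A j] A j labels_subset[OF L(1)] by auto
      then show ?thesis
        using False by (simp add: t_def power_mult_distrib mult_right_mono power_mono)
    qed
  qed simp
  finally show ?thesis .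
qed

subsection \<open>Overlap moments\<close>

definition overlap_moment :: "nat \<Rightarrow> (nat \<Rightarrow> real) pmf \<Rightarrow> nat \<Rightarrow> real" where
  "overlap_moment n P k = (\<integral>\<omega>. overlap n (fst \<omega>) (snd \<omega>) ^ k \<partial>measure_pmf (pair_pmf P P))"

abbreviation hadamard :: "(nat \<Rightarrow> real) \<times> (nat \<Rightarrow> real) \<Rightarrow> nat \<Rightarrow> real" where
  "hadamard \<omega> \<equiv> \<lambda>k. fst \<omega> k * snd \<omega> k"

lemma all_moments_fst_pair_pmf:
  assumes "all_moments (measure_pmf A) f"
  shows "all_moments (measure_pmf (pair_pmf A B)) (\<lambda>\<omega>. f (fst \<omega>))"
proof -
  have "integrable (measure_pmf (pair_pmf A B)) (\<lambda>\<omega>. \<bar>f (fst \<omega>)\<bar> ^ k * 1)" for k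
    using assms by (intro integrable_pair_pmf_mult[where g = "\<lambda>_. 1"]) (auto simp: all_moments_def)
  then show ?thesis by (simp add: all_moments_def)
qed

lemma all_moments_snd_pair_pmf:
  assumes "all_moments (measure_pmf B) f"
  shows "all_moments (measure_pmf (pair_pmf A B)) (\<lambda>\<omega>. f (snd \<omega>))"
proof -
  have "integrable (measure_pmf (pair_pmf A B)) (\<lambda>\<omega>. 1 * \<bar>f (snd \<omega>)\<bar> ^ k)" for k
    using assms by (intro integrable_pair_pmf_mult[where f = "\<lambda>_. 1"]) (auto simp: all_moments_def)
  then show ?thesis by (simp add: all_moments_def)
qed

lemma lmon_hadamard: "lmon (hadamard \<omega>) L = lmon (fst \<omega>) L * lmon (snd \<omega>) L"
  by (simp add: lmon_def prod.distrib)

lemma overlap_eq_sum_hadamard: "overlap n (fst \<omega>) (snd \<omega>) = (\<Sum>k<n. hadamard \<omega> k)"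
  by (simp add: overlap_def)

lemma all_moments_lmon_hadamard:
  assumes "coordinate_moments n P" "labels n L"
  shows "all_moments (measure_pmf (pair_pmf P P)) (\<lambda>\<omega>. lmon (hadamard \<omega>) L)"
  unfolding lmon_hadamard
  by (intro all_moments_mult all_moments_fst_pair_pmf[where f = "\<lambda>x. lmon x L"]
      all_moments_snd_pair_pmf[where f = "\<lambda>x. lmon x L"] all_moments_lmon_prior[OF assms])

lemma all_moments_overlap:
  assumes "coordinate_moments n P"
  shows "all_moments (measure_pmf (pair_pmf P P)) (\<lambda>\<omega>. overlap n (fst \<omega>) (snd \<omega>))"
  unfolding overlap_def
  by (intro all_moments_sum all_moments_mult all_moments_fst_pair_pmf[where f = "\<lambda>x. x _"]
      all_moments_snd_pair_pmf[where f = "\<lambda>x. x _"] measure_pmf.prob_space_axioms)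
     (use assms in \<open>auto simp: coordinate_moments_def\<close>)

text \<open>The square of a moment is a moment of two independent replicas, that is, of their
  coordinatewise product, whose coordinates sum to the overlap.\<close>

lemma mom_square:
  assumes "coordinate_moments n P" "labels n L"
  shows "(mom P L)\<^sup>2 = (\<integral>\<omega>. lmon (hadamard \<omega>) L \<partial>measure_pmf (pair_pmf P P))"
  using all_moments_integrable[OF all_moments_lmon_prior[OF assms]]
  by (simp add: lmon_hadamard mom_def power2_eq_square
      integral_pair_pmf_mult[where f = "\<lambda>x. lmon x L" and g = "\<lambda>x. lmon x L"])

lemma labels_insert_copies: "i < n \<Longrightarrow> A \<subseteq> copies n \<alpha> \<Longrightarrow> labels n (insert (i, \<alpha> i) A)"
  using labels_subset[OF labels_copies, of A n \<alpha>] by (auto simp: labels_def)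

lemma lmon_insert_copies:
  assumes "A \<subseteq> copies n \<alpha>"
  shows "lmon u (insert (i, \<alpha> i) A) = u i * lmon u A"
proof -
  have "finite A" "(i, \<alpha> i) \<notin> A"
    using labels_finite[OF labels_subset[OF labels_copies assms]] assms by (auto simp: copies_def)
  then show ?thesis by (simp add: lmon_def)
qed

text \<open>One factor of the overlap is spent on the label of X_i and the remaining
  \<open>d\<close> factors are expanded by the multinomial theorem. Hence the power
  \<open>Suc d\<close> over the factorial of \<open>d\<close>.\<close>

lemma sum_mom_square:
  assumes P: "coordinate_moments n P"
  shows "(\<Sum>i<n. \<Sum>\<alpha>\<in>exact_indices n d. (mom P (insert (i, \<alpha> i) (copies n \<alpha>)))\<^sup>2 / (\<Prod>k<n. fact (\<alpha> k)))
    = overlap_moment n P (Suc d) / fact d"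
proof -
  let ?Q = "measure_pmf (pair_pmf P P)"
  have int: "integrable ?Q (\<lambda>\<omega>. lmon (hadamard \<omega>) (insert (i, \<alpha> i) (copies n \<alpha>)))" if "i < n" for i \<alpha>
    using that by (intro all_moments_integrable all_moments_lmon_hadamard[OF P] labels_insert_copies) auto
  have "overlap_moment n P (Suc d) / fact d
      = (\<integral>\<omega>. (\<Sum>i<n. \<Sum>\<alpha>\<in>exact_indices n d. lmon (hadamard \<omega>) (insert (i, \<alpha> i) (copies n \<alpha>)) / (\<Prod>k<n. fact (\<alpha> k))) \<partial>?Q)"
    unfolding overlap_moment_def Bochner_Integration.integral_divide_zero[symmetric]
  proof (intro Bochner_Integration.integral_cong refl)
    fix \<omega> :: "(nat \<Rightarrow> real) \<times> (nat \<Rightarrow> real)"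
    have "overlap n (fst \<omega>) (snd \<omega>) ^ Suc d / fact d
        = (\<Sum>i<n. hadamard \<omega> i * ((\<Sum>k<n. hadamard \<omega> k) ^ d / fact d))"
      by (simp add: overlap_eq_sum_hadamard sum_distrib_right sum_divide_distrib)
    also have "\<dots> = (\<Sum>i<n. \<Sum>\<alpha>\<in>exact_indices n d. lmon (hadamard \<omega>) (insert (i, \<alpha> i) (copies n \<alpha>)) / (\<Prod>k<n. fact (\<alpha> k)))"
      unfolding sum_lmon_copies[symmetric] sum_distrib_left
      by (intro sum.cong refl) (simp only: lmon_insert_copies[OF order_refl] times_divide_eq_right)
    finally show "overlap n (fst \<omega>) (snd \<omega>) ^ Suc d / fact d
        = (\<Sum>i<n. \<Sum>\<alpha>\<in>exact_indices n d. lmon (hadamard \<omega>) (insert (i, \<alpha> i) (copies n \<alpha>)) / (\<Prod>k<n. fact (\<alpha> k)))" .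
  qed
  also have "\<dots> = (\<Sum>i<n. \<Sum>\<alpha>\<in>exact_indices n d.
      (\<integral>\<omega>. lmon (hadamard \<omega>) (insert (i, \<alpha> i) (copies n \<alpha>)) \<partial>?Q) / (\<Prod>k<n. fact (\<alpha> k)))"
    using int by (simp add: Bochner_Integration.integral_sum)
  also have "\<dots> = (\<Sum>i<n. \<Sum>\<alpha>\<in>exact_indices n d. (mom P (insert (i, \<alpha> i) (copies n \<alpha>)))\<^sup>2 / (\<Prod>k<n. fact (\<alpha> k)))"
    by (intro sum.cong refl) (simp add: mom_square[OF P] labels_insert_copies)
  finally show ?thesis ..
qed

text \<open>Products of two squared moments call for two independent pairs of replicas. Summed over
  \<open>A\<close>, the monomials of the two pairs form the monomial of the sum u + v of their
  coordinatewise products, so the multinomial theorem yields a power of the sum of two overlaps,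
  which the binomial theorem separates.\<close>

lemma sum_mom_square_subsets:
  assumes P: "coordinate_moments n P"
  shows "(\<Sum>i<n. \<Sum>\<alpha>\<in>exact_indices n d. (\<Sum>A\<in>Pow (copies n \<alpha>).
      (mom P (insert (i, \<alpha> i) A))\<^sup>2 * (mom P (copies n \<alpha> - A))\<^sup>2) / (\<Prod>k<n. fact (\<alpha> k)))
    = (\<Sum>k\<le>d. (d choose k) * overlap_moment n P (Suc k) * overlap_moment n P (d - k)) / fact d"
proof -
  let ?Q = "pair_pmf P P"
  let ?QQ = "measure_pmf (pair_pmf ?Q ?Q)"
  let ?O = "\<lambda>\<omega>. overlap n (fst \<omega>) (snd \<omega>)"
  let ?t = "\<lambda>i \<alpha> A w. lmon (hadamard (fst w)) (insert (i, \<alpha> i) A) * lmon (hadamard (snd w)) (copies n \<alpha> - A)"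
  have ov: "integrable (measure_pmf ?Q) (\<lambda>\<omega>. ?O \<omega> ^ k)" for k
    by (intro all_moments_integrable all_moments_power measure_pmf.prob_space_axioms all_moments_overlap P)
  have int: "integrable (measure_pmf ?Q) (\<lambda>\<omega>. lmon (hadamard \<omega>) (insert (i, \<alpha> i) A))"
    "integrable (measure_pmf ?Q) (\<lambda>\<omega>. lmon (hadamard \<omega>) (copies n \<alpha> - A))"
    if "i < n" "A \<in> Pow (copies n \<alpha>)" for i A \<alpha>
    using that labels_insert_copies[of i n A \<alpha>] labels_subset[OF labels_copies, of "copies n \<alpha> - A" n \<alpha>]
    by (auto intro!: all_moments_integrable all_moments_lmon_hadamard[OF P])
  have "(\<Sum>k\<le>d. (d choose k) * overlap_moment n P (Suc k) * overlap_moment n P (d - k)) / fact d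
      = (\<integral>w. (\<Sum>k\<le>d. (d choose k) * (?O (fst w) ^ Suc k * ?O (snd w) ^ (d - k))) \<partial>?QQ) / fact d"
    unfolding overlap_moment_def mult.assoc
    by (subst Bochner_Integration.integral_sum)
       (auto intro!: sum.cong integrable_mult_right integrable_pair_pmf_mult ov
         simp: integral_pair_pmf_mult[OF ov ov] simp del: power_Suc)
  also have "\<dots> = (\<integral>w. (\<Sum>i<n. \<Sum>\<alpha>\<in>exact_indices n d. (\<Sum>A\<in>Pow (copies n \<alpha>). ?t i \<alpha> A w) / (\<Prod>k<n. fact (\<alpha> k))) \<partial>?QQ)"
    unfolding Bochner_Integration.integral_divide_zero[symmetric]
  proof (intro Bochner_Integration.integral_cong refl)
    fix w :: "((nat \<Rightarrow> real) \<times> (nat \<Rightarrow> real)) \<times> ((nat \<Rightarrow> real) \<times> (nat \<Rightarrow> real))"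
    let ?u = "hadamard (fst w)" and ?v = "hadamard (snd w)"
    have "(\<Sum>k\<le>d. (d choose k) * (?O (fst w) ^ Suc k * ?O (snd w) ^ (d - k))) / fact d
        = ?O (fst w) * ((?O (fst w) + ?O (snd w)) ^ d / fact d)"
      by (simp add: binomial_ring sum_distrib_left mult_ac)
    also have "?O (fst w) + ?O (snd w) = (\<Sum>k<n. ?u k + ?v k)"
      by (simp add: overlap_eq_sum_hadamard sum.distrib)
    also have "?O (fst w) = (\<Sum>i<n. ?u i)" by (simp add: overlap_eq_sum_hadamard)
    also have "(\<Sum>i<n. ?u i) * ((\<Sum>k<n. ?u k + ?v k) ^ d / fact d)
        = (\<Sum>i<n. \<Sum>\<alpha>\<in>exact_indices n d. ?u i * (lmon (\<lambda>k. ?u k + ?v k) (copies n \<alpha>) / (\<Prod>k<n. fact (\<alpha> k))))"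
      unfolding sum_lmon_copies[symmetric] sum_distrib_left sum_distrib_right by (rule sum.swap)
    also have "\<dots> = (\<Sum>i<n. \<Sum>\<alpha>\<in>exact_indices n d. (\<Sum>A\<in>Pow (copies n \<alpha>). ?t i \<alpha> A w) / (\<Prod>k<n. fact (\<alpha> k)))"
    proof (intro sum.cong refl)
      fix i \<alpha>
      have "?u i * lmon (\<lambda>k. ?u k + ?v k) (copies n \<alpha>)
          = (\<Sum>A\<in>Pow (copies n \<alpha>). ?u i * (lmon ?u A * lmon ?v (copies n \<alpha> - A)))"
        unfolding lmon_def prod_add[OF labels_finite[OF labels_copies]] sum_distrib_left ..
      also have "\<dots> = (\<Sum>A\<in>Pow (copies n \<alpha>). ?t i \<alpha> A w)"
      proof (intro sum.cong refl)
        fix A assume "A \<in> Pow (copies n \<alpha>)"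
        then have "lmon ?u (insert (i, \<alpha> i) A) = ?u i * lmon ?u A"
          by (intro lmon_insert_copies) simp
        then show "?u i * (lmon ?u A * lmon ?v (copies n \<alpha> - A)) = ?t i \<alpha> A w" by simp
      qed
      finally show "?u i * (lmon (\<lambda>k. ?u k + ?v k) (copies n \<alpha>) / (\<Prod>k<n. fact (\<alpha> k)))
          = (\<Sum>A\<in>Pow (copies n \<alpha>). ?t i \<alpha> A w) / (\<Prod>k<n. fact (\<alpha> k))" by simp
    qed
    finally show "(\<Sum>k\<le>d. (d choose k) * (?O (fst w) ^ Suc k * ?O (snd w) ^ (d - k))) / fact d
        = (\<Sum>i<n. \<Sum>\<alpha>\<in>exact_indices n d. (\<Sum>A\<in>Pow (copies n \<alpha>). ?t i \<alpha> A w) / (\<Prod>k<n. fact (\<alpha> k)))"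
      by (simp only: overlap_eq_sum_hadamard)
  qed
  also have "\<dots> = (\<Sum>i<n. \<Sum>\<alpha>\<in>exact_indices n d. (\<Sum>A\<in>Pow (copies n \<alpha>).
      (\<integral>w. ?t i \<alpha> A w \<partial>?QQ)) / (\<Prod>k<n. fact (\<alpha> k)))"
  proof -
    have t: "integrable ?QQ (?t i \<alpha> A)" if "i < n" "A \<in> Pow (copies n \<alpha>)" for i \<alpha> A
      by (rule integrable_pair_pmf_mult[OF int[OF that]])
    let ?g = "\<lambda>i \<alpha> w. (\<Sum>A\<in>Pow (copies n \<alpha>). ?t i \<alpha> A w) / (\<Prod>k<n. fact (\<alpha> k))"
    have g: "integrable ?QQ (?g i \<alpha>)" if "i < n" for i \<alpha>
      by (intro integrable_divide_zero Bochner_Integration.integrable_sum t that)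
    have "(\<integral>w. (\<Sum>i<n. \<Sum>\<alpha>\<in>exact_indices n d. ?g i \<alpha> w) \<partial>?QQ)
        = (\<Sum>i<n. \<integral>w. (\<Sum>\<alpha>\<in>exact_indices n d. ?g i \<alpha> w) \<partial>?QQ)"
      by (intro Bochner_Integration.integral_sum Bochner_Integration.integrable_sum g) simp
    also have "\<dots> = (\<Sum>i<n. \<Sum>\<alpha>\<in>exact_indices n d. \<integral>w. ?g i \<alpha> w \<partial>?QQ)"
      by (intro sum.cong refl Bochner_Integration.integral_sum g) simp
    also have "\<dots> = (\<Sum>i<n. \<Sum>\<alpha>\<in>exact_indices n d. (\<Sum>A\<in>Pow (copies n \<alpha>).
        (\<integral>w. ?t i \<alpha> A w \<partial>?QQ)) / (\<Prod>k<n. fact (\<alpha> k)))"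
      unfolding Bochner_Integration.integral_divide_zero
      by (intro sum.cong refl arg_cong2[of _ _ _ _ "(/)"] Bochner_Integration.integral_sum t) auto
    finally show ?thesis .
  qed
  also have "\<dots> = (\<Sum>i<n. \<Sum>\<alpha>\<in>exact_indices n d. (\<Sum>A\<in>Pow (copies n \<alpha>).
      (mom P (insert (i, \<alpha> i) A))\<^sup>2 * (mom P (copies n \<alpha> - A))\<^sup>2) / (\<Prod>k<n. fact (\<alpha> k)))"
  proof (intro sum.cong refl arg_cong2[of _ _ _ _ "(/)"])
    fix i \<alpha> A assume A: "i \<in> {..<n}" "A \<in> Pow (copies n \<alpha>)"
    then have "labels n (insert (i, \<alpha> i) A)" "labels n (copies n \<alpha> - A)"
      using labels_insert_copies[of i n A \<alpha>] labels_subset[OF labels_copies, of "copies n \<alpha> - A" n \<alpha>] by auto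
    then show "(\<integral>w. ?t i \<alpha> A w \<partial>?QQ) = (mom P (insert (i, \<alpha> i) A))\<^sup>2 * (mom P (copies n \<alpha> - A))\<^sup>2"
      using integral_pair_pmf_mult[OF int[of i A \<alpha>]] A by (simp add: mom_square[OF P])
  qed
  finally show ?thesis ..
qed

text \<open>The cumulant sum is layered by degree. A layer \<open>d < D\<close> contains cumulants
  of order at most \<open>D\<close>, which moments dominate; the layer \<open>d = D\<close> goes
  through \<open>cumulant_square_le\<close>, and this is where the factor \<open>2 ^ D\<close>
  enters.\<close>

lemma Corr_le_overlap:
  assumes P: "coordinate_moments n P" and snr: "snr \<ge> 0"
    and \<kappa>: "\<And>\<alpha>. \<alpha> \<in> multi_indices n D \<Longrightarrow> cumulant n P \<alpha> \<ge> 0"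
  shows "(Corr_le n P D snr)\<^sup>2 \<le> (\<Sum>d<D. snr ^ d * overlap_moment n P (Suc d) / fact d)
    + (2 * snr) ^ D * (\<Sum>k\<le>D. (D choose k) * overlap_moment n P (Suc k) * overlap_moment n P (D - k)) / fact D"
proof -
  let ?\<kappa> = "\<lambda>i \<alpha>. (cumulant n P (\<alpha>(i := Suc (\<alpha> i))))\<^sup>2"
  let ?f = "\<lambda>\<alpha>. (\<Prod>k<n. fact (\<alpha> k)) :: real"
  let ?T = "\<lambda>d. \<Sum>i<n. \<Sum>\<alpha>\<in>exact_indices n d. ?\<kappa> i \<alpha> / ?f \<alpha>"
  have f: "?f \<alpha> > 0" for \<alpha> by (intro prod_pos) simp
  have c: "cnt (copies n \<alpha>) = \<alpha>" "card (copies n \<alpha>) = d" if "\<alpha> \<in> exact_indices n d" for \<alpha> d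
    using that by (auto simp: exact_indices_def card_copies intro!: cnt_copies)
  have nin: "(i, \<alpha> i) \<notin> copies n \<alpha>" for i \<alpha> by (simp add: copies_def)
  have "(Corr_le n P D snr)\<^sup>2 \<le> (\<Sum>i<n. \<Sum>\<alpha>\<in>multi_indices n D. snr ^ (\<Sum>k<n. \<alpha> k) * ?\<kappa> i \<alpha> / ?f \<alpha>)"
    by (rule Corr_le_sum_cumulants[OF P snr])
  also have "\<dots> = (\<Sum>d\<le>D. snr ^ d * ?T d)"
    unfolding sum_multi_indices sum_distrib_left
    by (subst sum.swap) (auto intro!: sum.cong simp: exact_indices_def)
  also have "\<dots> = (\<Sum>d<D. snr ^ d * ?T d) + snr ^ D * ?T D"
    by (simp add: lessThan_Suc_atMost[symmetric])
  also have "\<dots> \<le> (\<Sum>d<D. snr ^ d * (overlap_moment n P (Suc d) / fact d))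
      + snr ^ D * (2 ^ D * ((\<Sum>k\<le>D. (D choose k) * overlap_moment n P (Suc k) * overlap_moment n P (D - k)) / fact D))"
  proof (intro add_mono sum_mono mult_left_mono)
    fix d assume d: "d \<in> {..<D}"
    show "?T d \<le> overlap_moment n P (Suc d) / fact d"
      unfolding sum_mom_square[OF P, symmetric]
    proof (intro sum_mono divide_right_mono)
      fix i \<alpha> assume "i \<in> {..<n}" "\<alpha> \<in> exact_indices n d"
      then show "?\<kappa> i \<alpha> \<le> (mom P (insert (i, \<alpha> i) (copies n \<alpha>)))\<^sup>2"
        using cumulant_le_mom[OF \<kappa> labels_copies[of n \<alpha>], of D "(i, \<alpha> i)"] c[of \<alpha> d] nin d
        by (intro power_mono) auto
    qed (use f in \<open>simp add: less_imp_le\<close>)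
  next
    have "?T D \<le> (\<Sum>i<n. \<Sum>\<alpha>\<in>exact_indices n D. 2 ^ D * ((\<Sum>A\<in>Pow (copies n \<alpha>).
      (mom P (insert (i, \<alpha> i) A))\<^sup>2 * (mom P (copies n \<alpha> - A))\<^sup>2) / ?f \<alpha>))"
      unfolding times_divide_eq_right
    proof (intro sum_mono divide_right_mono)
      fix i \<alpha> assume "i \<in> {..<n}" "\<alpha> \<in> exact_indices n D"
      then show "?\<kappa> i \<alpha> \<le> 2 ^ D * (\<Sum>A\<in>Pow (copies n \<alpha>). (mom P (insert (i, \<alpha> i) A))\<^sup>2 * (mom P (copies n \<alpha> - A))\<^sup>2)"
        using cumulant_square_le[OF \<kappa> labels_copies[of n \<alpha>], of D "(i, \<alpha> i)"] c[of \<alpha> D] nin by auto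
    qed (use f in \<open>simp add: less_imp_le\<close>)
    then show "?T D \<le> 2 ^ D * ((\<Sum>k\<le>D. (D choose k) * overlap_moment n P (Suc k) * overlap_moment n P (D - k)) / fact D)"
      unfolding sum_mom_square_subsets[OF P, symmetric] sum_distrib_left .
  qed (use snr in simp_all)
  finally show ?thesis by (simp add: power_mult_distrib mult_ac)
qed

text \<open>In the top layer, \<open>2 ^ D\<close> from the squared sum over subsets meets
  \<open>2 ^ D\<close> from the binomial row sum, which gives the 4. The lower layers would only
  need the powers of \<open>snr * q\<close>; they are enlarged so that all layers fit into one
  exponential series, and \<open>c \<ge> 1\<close> lets the single factor \<open>c\<close> there be
  replaced by its square.\<close>

lemma Corr_le_of_overlap_moments:
  assumes P: "coordinate_moments n P" and snr: "snr \<ge> 0"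
    and \<kappa>: "\<And>\<alpha>. \<alpha> \<in> multi_indices n D \<Longrightarrow> cumulant n P \<alpha> \<ge> 0"
    and q: "q \<ge> 0" and c: "c \<ge> 1"
    and m: "\<And>k. k \<le> Suc D \<Longrightarrow> \<bar>overlap_moment n P k\<bar> \<le> c * q ^ k"
  shows "(Corr_le n P D snr)\<^sup>2 \<le> c\<^sup>2 * q * exp (4 * (snr * q))"
proof -
  let ?x = "4 * (snr * q)"
  have x: "?x \<ge> 0" using snr q by simp
  have "(Corr_le n P D snr)\<^sup>2 \<le> (\<Sum>d<D. snr ^ d * overlap_moment n P (Suc d) / fact d)
    + (2 * snr) ^ D * (\<Sum>k\<le>D. (D choose k) * overlap_moment n P (Suc k) * overlap_moment n P (D - k)) / fact D"
    by (rule Corr_le_overlap[OF P snr \<kappa>])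
  also have "\<dots> \<le> (\<Sum>d<D. c\<^sup>2 * q * (?x ^ d / fact d)) + c\<^sup>2 * q * (?x ^ D / fact D)"
  proof (intro add_mono sum_mono)
    fix d assume d: "d \<in> {..<D}"
    have "overlap_moment n P (Suc d) \<le> c * q ^ Suc d" using m[of "Suc d"] d by auto
    then have "snr ^ d * overlap_moment n P (Suc d) / fact d \<le> snr ^ d * (c * q ^ Suc d) / fact d"
      using snr by (intro divide_right_mono mult_left_mono) auto
    also have "\<dots> = c * q * ((snr * q) ^ d / fact d)" by (simp add: power_mult_distrib)
    also have "\<dots> \<le> c\<^sup>2 * q * (?x ^ d / fact d)"
    proof (rule mult_mono)
      show "c * q \<le> c\<^sup>2 * q"
        using c q by (intro mult_right_mono) (auto simp: power2_eq_square)
      have "(snr * q) ^ d \<le> ?x ^ d" using snr q by (intro power_mono) auto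
      then show "(snr * q) ^ d / fact d \<le> ?x ^ d / fact d" by (rule divide_right_mono) simp
    qed (use q snr in auto)
    finally show "snr ^ d * overlap_moment n P (Suc d) / fact d \<le> c\<^sup>2 * q * (?x ^ d / fact d)" .
  next
    have "(\<Sum>k\<le>D. (D choose k) * overlap_moment n P (Suc k) * overlap_moment n P (D - k))
        \<le> (\<Sum>k\<le>D. (D choose k) * (c\<^sup>2 * q ^ Suc D))"
    proof (intro sum_mono)
      fix k assume k: "k \<in> {..D}"
      have "overlap_moment n P (Suc k) * overlap_moment n P (D - k) \<le> \<bar>overlap_moment n P (Suc k)\<bar> * \<bar>overlap_moment n P (D - k)\<bar>"
        by (metis abs_ge_self abs_mult)
      also have "\<dots> \<le> (c * q ^ Suc k) * (c * q ^ (D - k))"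
        using m[of "Suc k"] m[of "D - k"] k c q by (intro mult_mono) auto
      also have "\<dots> = c\<^sup>2 * q ^ Suc D"
        using k by (simp add: power2_eq_square power_add[symmetric])
      finally have "overlap_moment n P (Suc k) * overlap_moment n P (D - k) \<le> c\<^sup>2 * q ^ Suc D" .
      then show "(D choose k) * overlap_moment n P (Suc k) * overlap_moment n P (D - k) \<le> (D choose k) * (c\<^sup>2 * q ^ Suc D)"
        unfolding mult.assoc by (intro mult_left_mono) auto
    qed
    also have "\<dots> = 2 ^ D * (c\<^sup>2 * q ^ Suc D)"
      by (simp add: sum_distrib_right[symmetric] choose_row_sum of_nat_sum[symmetric] del: of_nat_sum)
    finally have "(2 * snr) ^ D * (\<Sum>k\<le>D. (D choose k) * overlap_moment n P (Suc k) * overlap_moment n P (D - k)) / fact D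
        \<le> (2 * snr) ^ D * (2 ^ D * (c\<^sup>2 * q ^ Suc D)) / fact D"
      using snr by (intro divide_right_mono mult_left_mono) auto
    also have "\<dots> = c\<^sup>2 * q * (?x ^ D / fact D)"
      using power_mult_distrib[of "2 :: real" 2 D] by (simp add: power_mult_distrib)
    finally show "(2 * snr) ^ D * (\<Sum>k\<le>D. (D choose k) * overlap_moment n P (Suc k) * overlap_moment n P (D - k)) / fact D
        \<le> c\<^sup>2 * q * (?x ^ D / fact D)" .
  qed
  also have "\<dots> = c\<^sup>2 * q * (\<Sum>d<Suc D. ?x ^ d / fact d)"
    by (simp add: sum_distrib_left distrib_left)
  also have "(\<Sum>d<Suc D. ?x ^ d / fact d) \<le> exp ?x"
  proof -
    have "(\<Sum>d<Suc D. ?x ^ d /\<^sub>R fact d) \<le> (\<Sum>d. ?x ^ d /\<^sub>R fact d)"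
      using x by (intro sum_le_suminf summable_exp_generic scaleR_nonneg_nonneg zero_le_power) simp_all
    then show ?thesis by (simp only: exp_def divide_inverse real_scaleR_def mult.commute)
  qed
  finally show ?thesis using q by (simp add: mult_left_mono)
qed

subsection \<open>Quantiles and tails of the overlap\<close>

text \<open>The set is a superlevel set of the distribution function of the absolute overlap; by
  right continuity the infimum belongs to it, so the tail bound holds at the quantile
  itself.\<close>

lemma overlap_quantile_set:
  fixes n :: nat and P :: "(nat \<Rightarrow> real) pmf" and T :: real
  assumes T: "T > 0"
  defines "S \<equiv> {y. measure_pmf.prob (overlap_pmf n P) {t. \<bar>t\<bar> \<le> y} \<ge> 1 - exp (- T)}"
  shows overlap_quantile_set_nonempty: "S \<noteq> {}"
    and overlap_quantile_set_bdd_below: "bdd_below S"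
    and overlap_quantile_in_set: "overlap_quantile n P T \<in> S"
proof -
  let ?M = "distr (measure_pmf (overlap_pmf n P)) borel (\<lambda>t. \<bar>t\<bar>)"
  interpret real_distribution ?M
    by (rule real_distribution.intro[OF prob_space.prob_space_distr[OF measure_pmf.prob_space_axioms]])
       (simp_all add: real_distribution_axioms_def)
  have F: "measure_pmf.prob (overlap_pmf n P) {t. \<bar>t\<bar> \<le> y} = cdf ?M y" for y
    by (simp add: cdf_def measure_distr vimage_def)
  have S: "S = {y. cdf ?M y \<ge> 1 - exp (- T)}" by (simp add: S_def F)
  have "1 - exp (- T) < 1" by simp
  from order_tendstoD(1)[OF cdf_lim_at_top_prob this]
  obtain y where "1 - exp (- T) < cdf ?M y"
    unfolding eventually_at_top_linorder by blast
  then have "y \<in> S" by (simp add: S)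
  then show ne: "S \<noteq> {}" by blast
  \<comment> \<open>For positive \<open>T\<close> the required probability is positive, which
    excludes negative \<open>y\<close>.\<close>
  have "0 \<le> y" if "y \<in> S" for y
  proof (rule ccontr)
    assume "\<not> 0 \<le> y"
    then have "{t. \<bar>t\<bar> \<le> y} = {}" by auto
    then show False using that T by (simp add: S_def)
  qed
  then show bdd: "bdd_below S" by (rule bdd_belowI)
  let ?q = "Inf S"
  have "cdf ?M ?q \<ge> 1 - exp (- T)"
  proof (rule ccontr)
    assume *: "\<not> ?thesis"
    have "(cdf ?M \<longlongrightarrow> cdf ?M ?q) (at_right ?q)"
      using cdf_is_right_cont[of ?q] by (simp add: continuous_within)
    then have "\<forall>\<^sub>F y in at_right ?q. cdf ?M y < 1 - exp (- T)"
      using * by (intro order_tendstoD(2)) auto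
    then obtain b where b: "b > ?q" "\<And>y. y > ?q \<Longrightarrow> y < b \<Longrightarrow> cdf ?M y < 1 - exp (- T)"
      unfolding eventually_at_right_field by auto
    obtain y where y: "y \<in> S" "y < b" using cInf_lessD[OF ne b(1)] by auto
    have "y \<ge> ?q" using cInf_lower[OF y(1) bdd] .
    then show False using y b(2)[of y] * by (cases "y = ?q") (auto simp: S)
  qed
  then show "overlap_quantile n P T \<in> S"
    unfolding overlap_quantile_def S by (simp add: F)
qed

lemma overlap_quantile_mono:
  assumes "0 < T" "T \<le> T'"
  shows "overlap_quantile n P T \<le> overlap_quantile n P T'"
proof -
  have T': "0 < T'" using assms by simp
  show ?thesis
    unfolding overlap_quantile_def
  proof (rule cInf_superset_mono[OF overlap_quantile_set_nonempty[OF T'] overlap_quantile_set_bdd_below[OF assms(1)]])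
    have "exp (- T') \<le> exp (- T)" using assms by simp
    then show "{y. measure_pmf.prob (overlap_pmf n P) {t. \<bar>t\<bar> \<le> y} \<ge> 1 - exp (- T')}
      \<subseteq> {y. measure_pmf.prob (overlap_pmf n P) {t. \<bar>t\<bar> \<le> y} \<ge> 1 - exp (- T)}"
      by (intro Collect_mono impI) linarith
  qed
qed

lemma overlap_quantile_tail:
  assumes "T > 0"
  shows "measure_pmf.prob (pair_pmf P P) {\<omega>. \<bar>overlap n (fst \<omega>) (snd \<omega>)\<bar> > overlap_quantile n P T} \<le> exp (- T)"
proof -
  let ?q = "overlap_quantile n P T"
  have "1 - exp (- T) \<le> measure_pmf.prob (overlap_pmf n P) {t. \<bar>t\<bar> \<le> ?q}"
    using overlap_quantile_in_set[OF assms] by simp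
  also have "\<dots> = measure_pmf.prob (pair_pmf P P) {\<omega>. \<bar>overlap n (fst \<omega>) (snd \<omega>)\<bar> \<le> ?q}"
    by (simp add: overlap_pmf_def vimage_def case_prod_beta)
  also have "\<dots> = 1 - measure_pmf.prob (pair_pmf P P) (- {\<omega>. \<bar>overlap n (fst \<omega>) (snd \<omega>)\<bar> \<le> ?q})"
    by (simp add: measure_pmf.prob_compl[symmetric] Compl_eq_Diff_UNIV Diff_Diff_Int)
  also have "- {\<omega>. \<bar>overlap n (fst \<omega>) (snd \<omega>)\<bar> \<le> ?q} = {\<omega>. \<bar>overlap n (fst \<omega>) (snd \<omega>)\<bar> > ?q}"
    by auto
  finally show ?thesis by simp
qed

text \<open>Up to the quantile the overlap is bounded by \<open>q\<close>. Beyond it, Cauchy-Schwarz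
  trades the tail for a moment of doubled order times the tail probability, both under a square
  root.\<close>

lemma overlap_moment_truncation:
  assumes P: "coordinate_moments n P" and T: "T > 0"
    and q: "overlap_quantile n P T = q" "q \<ge> 0"
  shows "\<bar>overlap_moment n P k\<bar> \<le> q ^ k + sqrt (overlap_moment n P (2 * k) * exp (- T))"
proof -
  let ?Q = "measure_pmf (pair_pmf P P)"
  let ?O = "\<lambda>\<omega>. overlap n (fst \<omega>) (snd \<omega>)"
  let ?E = "{\<omega>. \<bar>?O \<omega>\<bar> > q}"
  have m: "all_moments ?Q (\<lambda>\<omega>. \<bar>?O \<omega>\<bar> ^ k)"
    using all_moments_power[OF measure_pmf.prob_space_axioms all_moments_overlap[OF P], of k]
    by (simp add: all_moments_def power_abs)
  have i: "integrable ?Q (indicator ?E :: _ \<Rightarrow> real)" by (simp add: measure_pmf.emeasure_finite less_top[symmetric])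
  have im: "integrable ?Q (\<lambda>\<omega>. \<bar>?O \<omega>\<bar> ^ k * indicator ?E \<omega>)"
    by (rule Bochner_Integration.integrable_bound[OF all_moments_integrable[OF m]])
       (auto simp: indicator_def)
  have sq: "(indicator ?E \<omega> :: real)\<^sup>2 = indicator ?E \<omega>" "(\<bar>?O \<omega>\<bar> ^ k)\<^sup>2 = ?O \<omega> ^ (2 * k)" for \<omega>
    by (simp_all add: indicator_def power_mult[symmetric] mult.commute[of k] power_even_abs)
  have "(\<integral>\<omega>. \<bar>?O \<omega>\<bar> ^ k * indicator ?E \<omega> \<partial>?Q)\<^sup>2
      \<le> (\<integral>\<omega>. (\<bar>?O \<omega>\<bar> ^ k)\<^sup>2 \<partial>?Q) * (\<integral>\<omega>. (indicator ?E \<omega>)\<^sup>2 \<partial>?Q)"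
    using all_moments_integrable[OF all_moments_power[OF measure_pmf.prob_space_axioms m, of 2]] i im
    by (intro Cauchy_Schwarz_integral) (simp_all only: sq)
  also have "\<dots> = overlap_moment n P (2 * k) * measure_pmf.prob (pair_pmf P P) ?E"
    by (simp only: sq) (simp add: overlap_moment_def)
  also have "\<dots> \<le> overlap_moment n P (2 * k) * exp (- T)"
    using overlap_quantile_tail[OF T, of P n] q
    by (intro mult_left_mono) (auto simp: overlap_moment_def intro!: integral_nonneg_AE)
  finally have tail: "(\<integral>\<omega>. \<bar>?O \<omega>\<bar> ^ k * indicator ?E \<omega> \<partial>?Q) \<le> sqrt (overlap_moment n P (2 * k) * exp (- T))"
    by (rule real_le_rsqrt)
  have "\<bar>overlap_moment n P k\<bar> \<le> (\<integral>\<omega>. \<bar>?O \<omega>\<bar> ^ k \<partial>?Q)"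
    unfolding overlap_moment_def power_abs[symmetric] by (rule integral_abs_bound)
  also have "\<dots> \<le> (\<integral>\<omega>. q ^ k + \<bar>?O \<omega>\<bar> ^ k * indicator ?E \<omega> \<partial>?Q)"
  proof (rule integral_mono[OF all_moments_integrable[OF m]])
    show "integrable ?Q (\<lambda>\<omega>. q ^ k + \<bar>?O \<omega>\<bar> ^ k * indicator ?E \<omega>)"
      using im by simp
    show "\<bar>?O \<omega>\<bar> ^ k \<le> q ^ k + \<bar>?O \<omega>\<bar> ^ k * indicator ?E \<omega>" for \<omega>
      using q(2) by (cases "\<bar>?O \<omega>\<bar> > q") (auto intro: power_mono)
  qed
  also have "\<dots> = q ^ k + (\<integral>\<omega>. \<bar>?O \<omega>\<bar> ^ k * indicator ?E \<omega> \<partial>?Q)"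
    using im by simp
  finally show ?thesis using tail by simp
qed

section \<open>Sub-Weibull marginals and even overlap moments\<close>

lemma abs_powr_of_nat: "k \<ge> 1 \<Longrightarrow> \<bar>x :: real\<bar> powr real k = \<bar>x\<bar> ^ k"
  \<comment> \<open>At \<open>x = 0\<close> the condition \<open>k \<ge> 1\<close> matters:
    \<open>0 powr 0\<close> is 0, while \<open>0 ^ 0\<close> is 1.\<close>
  by (cases "x = 0") (simp_all add: powr_realpow)

lemma sub_weibull_all_moments:
  assumes "sub_weibull (measure_pmf P) X \<phi> K C"
  shows "all_moments (measure_pmf P) X"
proof -
  have "integrable (measure_pmf P) (\<lambda>\<omega>. \<bar>X \<omega>\<bar> ^ k)" for k
  proof (cases "k \<ge> 1")
    case True
    then have "integrable (measure_pmf P) (\<lambda>\<omega>. \<bar>X \<omega>\<bar> powr real k)"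
      using assms by (simp add: sub_weibull_def)
    then show ?thesis using True by (simp add: abs_powr_of_nat)
  next
    case False
    then show ?thesis by (simp add: not_le)
  qed
  then show ?thesis by (simp add: all_moments_def)
qed

lemma sub_weibull_moment:
  assumes "sub_weibull (measure_pmf P) X \<phi> K C" and k: "k \<ge> 1"
  shows "(\<integral>\<omega>. \<bar>X \<omega>\<bar> ^ k \<partial>measure_pmf P) \<le> (C * K * real k powr (1 / \<phi>)) ^ k"
proof -
  let ?I = "\<integral>\<omega>. \<bar>X \<omega>\<bar> ^ k \<partial>measure_pmf P"
  have "?I powr (1 / k) \<le> C * K * real k powr (1 / \<phi>)"
    using assms by (auto simp: sub_weibull_def abs_powr_of_nat dest!: spec[of _ "real k"])
  then have "(?I powr (1 / k)) ^ k \<le> (C * K * real k powr (1 / \<phi>)) ^ k"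
    by (intro power_mono) auto
  moreover have "?I \<ge> 0" by (intro integral_nonneg_AE) simp
  then have "(?I powr (1 / k)) ^ k = ?I"
    using k by (cases "?I = 0") (simp_all add: powr_power)
  ultimately show ?thesis by simp
qed

text \<open>Comparison with the largest term. The loss of one factor of the cardinality per power is
  affordable, since the tail probability is smaller than any fixed power of n to the D.\<close>

lemma abs_sum_power_le:
  fixes f :: "'i \<Rightarrow> real"
  assumes "finite I" "k \<ge> 1"
  shows "\<bar>\<Sum>i\<in>I. f i\<bar> ^ k \<le> real (card I) ^ k * (\<Sum>i\<in>I. \<bar>f i\<bar> ^ k)"
proof (cases "I = {}")
  case True
  then show ?thesis using assms by (simp add: power_0_left)
next
  case False
  define m where "m = Max ((\<lambda>i. \<bar>f i\<bar>) ` I)"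
  have "m \<in> (\<lambda>i. \<bar>f i\<bar>) ` I" unfolding m_def using assms False by (intro Max_in) auto
  then obtain i where i: "i \<in> I" "m = \<bar>f i\<bar>" by auto
  have "\<bar>\<Sum>i\<in>I. f i\<bar> \<le> (\<Sum>i\<in>I. \<bar>f i\<bar>)" by (rule sum_abs)
  also have "\<dots> \<le> real (card I) * m"
    using assms by (intro sum_bounded_above) (auto simp: m_def)
  finally have "\<bar>\<Sum>i\<in>I. f i\<bar> ^ k \<le> (real (card I) * m) ^ k" by (intro power_mono) auto
  also have "\<dots> \<le> real (card I) ^ k * (\<Sum>i\<in>I. \<bar>f i\<bar> ^ k)"
    unfolding power_mult_distrib
    using i assms by (intro mult_left_mono) (auto intro: member_le_sum)
  finally show ?thesis .
qed

text \<open>Of the exponent \<open>2 * k + 1\<close> of n, \<open>2 * k\<close> comes from the power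
  of a sum and 1 from the number of coordinates. The square comes from the two independent
  replicas.\<close>

lemma overlap_moment_even_le:
  assumes w: "\<And>i. i < n \<Longrightarrow> sub_weibull (measure_pmf P) (\<lambda>x. x i) \<phi> K C" and k: "k \<ge> 1"
  shows "overlap_moment n P (2 * k) \<le> real n ^ (2 * k + 1) * ((C * K * real (2 * k) powr (1 / \<phi>)) ^ (2 * k))\<^sup>2"
proof -
  let ?Q = "measure_pmf (pair_pmf P P)" and ?B = "(C * K * real (2 * k) powr (1 / \<phi>)) ^ (2 * k)"
  have am: "all_moments (measure_pmf P) (\<lambda>x. x i)" if "i < n" for i
    by (rule sub_weibull_all_moments[OF w[OF that]])
  then have P: "coordinate_moments n P" by (simp add: coordinate_moments_def)
  have int: "integrable (measure_pmf P) (\<lambda>x. \<bar>x i\<bar> ^ (2 * k))" if "i < n" for i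
    using am[OF that] by (simp add: all_moments_def)
  have int2: "integrable ?Q (\<lambda>\<omega>. \<bar>fst \<omega> i\<bar> ^ (2 * k) * \<bar>snd \<omega> i\<bar> ^ (2 * k))" if "i < n" for i
    by (rule integrable_pair_pmf_mult[OF int[OF that] int[OF that]])
  have "overlap_moment n P (2 * k)
      \<le> (\<integral>\<omega>. real n ^ (2 * k) * (\<Sum>i<n. \<bar>fst \<omega> i\<bar> ^ (2 * k) * \<bar>snd \<omega> i\<bar> ^ (2 * k)) \<partial>?Q)"
    unfolding overlap_moment_def
  proof (rule integral_mono)
    show "integrable ?Q (\<lambda>\<omega>. overlap n (fst \<omega>) (snd \<omega>) ^ (2 * k))"
      by (intro all_moments_integrable all_moments_power measure_pmf.prob_space_axioms all_moments_overlap P)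
    show "integrable ?Q (\<lambda>\<omega>. real n ^ (2 * k) * (\<Sum>i<n. \<bar>fst \<omega> i\<bar> ^ (2 * k) * \<bar>snd \<omega> i\<bar> ^ (2 * k)))"
      by (intro integrable_mult_right Bochner_Integration.integrable_sum int2) simp
    fix \<omega> :: "(nat \<Rightarrow> real) \<times> (nat \<Rightarrow> real)"
    show "overlap n (fst \<omega>) (snd \<omega>) ^ (2 * k) \<le> real n ^ (2 * k) * (\<Sum>i<n. \<bar>fst \<omega> i\<bar> ^ (2 * k) * \<bar>snd \<omega> i\<bar> ^ (2 * k))"
      using abs_sum_power_le[of "{..<n}" "2 * k" "\<lambda>i. fst \<omega> i * snd \<omega> i"] k
      by (simp add: overlap_def abs_mult power_mult_distrib power_even_abs)
  qed
  also have "\<dots> = real n ^ (2 * k) * (\<Sum>i<n. \<integral>\<omega>. \<bar>fst \<omega> i\<bar> ^ (2 * k) * \<bar>snd \<omega> i\<bar> ^ (2 * k) \<partial>?Q)"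
    using int2 by (simp add: Bochner_Integration.integral_sum)
  also have "\<dots> \<le> real n ^ (2 * k) * (real (card {..<n}) * ?B\<^sup>2)"
  proof (intro mult_left_mono sum_bounded_above)
    fix i assume "i \<in> {..<n}"
    then have i: "i < n" by simp
    have "(\<integral>\<omega>. \<bar>fst \<omega> i\<bar> ^ (2 * k) * \<bar>snd \<omega> i\<bar> ^ (2 * k) \<partial>?Q) = (\<integral>x. \<bar>x i\<bar> ^ (2 * k) \<partial>measure_pmf P)\<^sup>2"
      unfolding power2_eq_square by (rule integral_pair_pmf_mult[OF int[OF i] int[OF i]])
    also have "\<dots> \<le> ?B\<^sup>2"
      using sub_weibull_moment[OF w[OF i], of "2 * k"] k
      by (intro power_mono integral_nonneg_AE) auto
    finally show "(\<integral>\<omega>. \<bar>fst \<omega> i\<bar> ^ (2 * k) * \<bar>snd \<omega> i\<bar> ^ (2 * k) \<partial>?Q) \<le> ?B\<^sup>2" .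
  qed simp
  finally show ?thesis by (simp add: mult_ac)
qed

section \<open>The correlation bound for a fixed dimension and for all large ones\<close>

lemma Corr_le_twice_quantile:
  fixes n D :: nat and C c \<phi> K C\<^sub>\<phi> C\<^sub>1 C\<^sub>3 snr :: real and P :: "(nat \<Rightarrow> real) pmf"
  defines "q \<equiv> overlap_quantile n P (real D * (ln (real n))\<^sup>2)"
  assumes n: "n \<ge> 10" "ln (real n) \<ge> 16" "ln (real n) \<ge> 8 + 4 * C\<^sub>3 + 4 * C\<^sub>1"
    and C\<^sub>3: "C\<^sub>3 \<ge> 0" "(C\<^sub>\<phi> * K)\<^sup>2 * (4 * real n powr C) powr (2 / \<phi>) \<le> real n powr C\<^sub>3"
    and D: "D > 0" "real D \<le> real n powr C"
    and \<kappa>: "\<And>\<alpha>. \<alpha> \<in> multi_indices n D \<Longrightarrow> cumulant n P \<alpha> \<ge> 0"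
    and \<phi>: "\<phi> > 0" and C\<^sub>1: "C\<^sub>1 > 0"
    and weibull: "\<And>i. i < n \<Longrightarrow> sub_weibull (measure_pmf P) (\<lambda>x. x i) \<phi> K C\<^sub>\<phi>"
    and q: "q \<ge> real n powr (- C\<^sub>1)"
    and snr: "snr \<ge> 0" "snr \<le> 1 / (q * ln (real n))"
  shows "(Corr_le n P D snr)\<^sup>2 \<le> 2 * q"
proof -
  define L where "L = ln (real n)"
  define T where "T = real D * L\<^sup>2"
  have n0: "real n > 0" and nL: "real n = exp L" using n by (simp_all add: L_def)
  have L: "L \<ge> 16" "L \<ge> 8 + 4 * C\<^sub>3 + 4 * C\<^sub>1" using n by (simp_all add: L_def)
  have T: "T > 0" using D L by (simp add: T_def)
  have powr_n: "real n powr x = exp (x * L)" for x using n0 by (simp add: powr_def L_def)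
  have q0: "q > 0" using q n0 by (smt (verit) powr_gt_zero)
  have P: "coordinate_moments n P"
    using sub_weibull_all_moments[OF weibull] by (simp add: coordinate_moments_def)
  have mom: "\<bar>overlap_moment n P k\<bar> \<le> (1 + 1 / real n) * q ^ k" if k: "k \<le> Suc D" for k
  proof (cases "k = 0")
    case True
    then show ?thesis by (simp add: overlap_moment_def)
  next
    case False
    then have k1: "k \<ge> 1" by simp
    \<comment> \<open>From \<open>k \<le> Suc D\<close> and \<open>D \<ge> 1\<close>. The order
      \<open>2 * k\<close> is then at most four times \<open>D\<close>, which is the 4 in the
      hypothesis on \<open>C\<^sub>3\<close>.\<close>
    have k2: "real k \<le> 2 * real D" using k D(1) by linarith
    let ?b = "C\<^sub>\<phi> * K * real (2 * k) powr (1 / \<phi>)"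
    have "?b\<^sup>2 = (C\<^sub>\<phi> * K)\<^sup>2 * real (2 * k) powr (2 / \<phi>)"
      using k1 by (simp add: power_mult_distrib powr_power)
    also have "\<dots> \<le> (C\<^sub>\<phi> * K)\<^sup>2 * (4 * real n powr C) powr (2 / \<phi>)"
      using k2 D(2) \<phi> by (intro mult_left_mono powr_mono2) auto
    also have "\<dots> \<le> exp (C\<^sub>3 * L)" using C\<^sub>3(2) by (simp add: powr_n)
    finally have b: "?b\<^sup>2 \<le> exp (C\<^sub>3 * L)" .
    have "overlap_moment n P (2 * k) \<le> real n ^ (2 * k + 1) * (?b ^ (2 * k))\<^sup>2"
      by (rule overlap_moment_even_le[OF weibull k1])
    also have "\<dots> = exp L ^ (2 * k + 1) * (?b\<^sup>2) ^ (2 * k)"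
      by (simp only: nL power_mult[symmetric] mult.commute)
    also have "\<dots> \<le> exp L ^ (2 * k + 1) * exp (C\<^sub>3 * L) ^ (2 * k)"
      using b by (intro mult_left_mono power_mono) auto
    also have "\<dots> = exp (real (2 * k + 1) * L + real (2 * k) * (C\<^sub>3 * L))"
      by (simp only: exp_of_nat_mult exp_add)
    finally have m2: "overlap_moment n P (2 * k) \<le> exp (real (2 * k + 1) * L + real (2 * k) * (C\<^sub>3 * L))" .
    have "exp (- (C\<^sub>1 * L)) ^ k \<le> q ^ k"
      using q by (intro power_mono) (auto simp: powr_n)
    then have "exp (- (C\<^sub>1 * L)) ^ k / real n \<le> q ^ k / real n"
      by (rule divide_right_mono) simp
    then have qk: "exp (- (real k * (C\<^sub>1 * L)) - L) \<le> q ^ k / real n"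
      by (simp add: nL exp_diff exp_of_nat_mult[symmetric])
    \<comment> \<open>The goal is that the doubled moment times the tail probability is at most the
      square of \<open>q ^ k / real n\<close>. Apart from \<open>T\<close>, all exponents add up to
      at most D (7 + 4 C_3 + 4 C_1) L, and the assumed size of \<open>L\<close> makes T = D L^2
      larger.\<close>
    have "real (2 * k + 1) * L + real (2 * k) * (C\<^sub>3 * L) - T \<le> 2 * (- (real k * (C\<^sub>1 * L)) - L)"
    proof -
      have "real (2 * k + 1) + real (2 * k) * C\<^sub>3 + 2 * real k * C\<^sub>1 + 2
          = real k * (2 + 2 * C\<^sub>3 + 2 * C\<^sub>1) + 3" by (simp add: algebra_simps)
      also have "\<dots> \<le> 2 * real D * (2 + 2 * C\<^sub>3 + 2 * C\<^sub>1) + 3 * real D"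
        using k2 C\<^sub>3 C\<^sub>1 D(1) by (intro add_mono mult_right_mono) auto
      also have "\<dots> = real D * (7 + 4 * C\<^sub>3 + 4 * C\<^sub>1)" by (simp add: algebra_simps)
      also have "\<dots> \<le> real D * L" using L by (intro mult_left_mono) auto
      finally have "(real (2 * k + 1) + real (2 * k) * C\<^sub>3 + 2 * real k * C\<^sub>1 + 2) * L \<le> real D * L * L"
        using L by (intro mult_right_mono) auto
      then show ?thesis by (simp add: T_def power2_eq_square algebra_simps)
    qed
    then have "exp (real (2 * k + 1) * L + real (2 * k) * (C\<^sub>3 * L)) * exp (- T)
        \<le> (exp (- (real k * (C\<^sub>1 * L)) - L))\<^sup>2"
      by (simp only: exp_add[symmetric] exp_double[symmetric] exp_le_cancel_iff)
    also have "\<dots> \<le> (q ^ k / real n)\<^sup>2" using qk by (intro power_mono) auto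
    finally have "exp (real (2 * k + 1) * L + real (2 * k) * (C\<^sub>3 * L)) * exp (- T) \<le> (q ^ k / real n)\<^sup>2" .
    then have "overlap_moment n P (2 * k) * exp (- T) \<le> (q ^ k / real n)\<^sup>2"
      using m2 by (meson exp_ge_zero mult_right_mono order_trans)
    then have "sqrt (overlap_moment n P (2 * k) * exp (- T)) \<le> q ^ k / real n"
      using q0 n0 by (intro real_le_lsqrt) auto
    moreover have "\<bar>overlap_moment n P k\<bar> \<le> q ^ k + sqrt (overlap_moment n P (2 * k) * exp (- T))"
      using q0 by (intro overlap_moment_truncation[OF P T]) (simp_all add: q_def T_def L_def)
    ultimately show ?thesis by (simp add: algebra_simps)
  qed
  have "(Corr_le n P D snr)\<^sup>2 \<le> (1 + 1 / real n)\<^sup>2 * q * exp (4 * (snr * q))"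
    by (rule Corr_le_of_overlap_moments[OF P snr(1) \<kappa>]) (use q0 mom in auto)
  \<comment> \<open>The thresholds n \<ge> 10 and L \<ge> 16 give 1 + 1/n \<le> 11/10 and an
    exponent of at most 1/4. The product 1.21 * 4/3 stays below 2.\<close>
  also have "\<dots> \<le> (11 / 10)\<^sup>2 * q * (4 / 3)"
  proof (intro mult_mono power_mono)
    show "1 + 1 / real n \<le> 11 / 10" using n by (simp add: field_simps)
    have "snr * q \<le> 1 / L" using snr(2) q0 L by (simp add: L_def field_simps)
    also have "\<dots> \<le> 1 / 16" using L by (intro divide_left_mono) auto
    finally have "exp (4 * (snr * q)) \<le> exp (1 / 4)" by simp
    also have "\<dots> \<le> 4 / 3"
    proof -
      have "3 / 4 \<le> exp (- (1 / 4) :: real)" using exp_ge_add_one_self[of "- (1 / 4) :: real"] by simp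
      then have "3 / 4 * exp (1 / 4) \<le> exp (- (1 / 4)) * exp (1 / 4 :: real)" by (intro mult_right_mono) auto
      then show ?thesis by (simp add: exp_add[symmetric])
    qed
    finally show "exp (4 * (snr * q)) \<le> 4 / 3" .
  qed (use q0 in auto)
  also have "\<dots> \<le> 2 * q" using q0 by (simp add: power2_eq_square)
  finally show ?thesis .
qed

text \<open>The quantifier over \<open>snr\<close> stands inside \<open>eventually\<close>: the
  threshold on n must not depend on the signal-to-noise ratio, because in the theorem u is arbitrary
  for each n.\<close>

lemma eventually_Corr_le_twice_quantile:
  fixes C \<phi> K C\<^sub>\<phi> C\<^sub>1 :: real and D :: "nat \<Rightarrow> nat" and P :: "nat \<Rightarrow> (nat \<Rightarrow> real) pmf"
  defines "q \<equiv> \<lambda>n. overlap_quantile n (P n) (real (D n) * (ln (real n))\<^sup>2)"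
  assumes C: "C > 0"
    and D: "\<And>n. n \<ge> 1 \<Longrightarrow> D n > 0 \<and> real (D n) \<le> real n powr C"
    and \<kappa>: "\<And>n \<alpha>. n \<ge> 1 \<Longrightarrow> \<alpha> \<in> multi_indices n (D n) \<Longrightarrow> cumulant n (P n) \<alpha> \<ge> 0"
    and \<phi>: "\<phi> > 0" and C\<^sub>1: "C\<^sub>1 > 0"
    and weibull: "\<And>n i. n \<ge> 1 \<Longrightarrow> i < n \<Longrightarrow> sub_weibull (measure_pmf (P n)) (\<lambda>x. x i) \<phi> K C\<^sub>\<phi>"
    and q: "\<And>n. n \<ge> 2 \<Longrightarrow> q n \<ge> real n powr (- C\<^sub>1)"
  shows "\<forall>\<^sub>F n in sequentially. \<forall>snr. 0 \<le> snr \<longrightarrow> snr \<le> 1 / (q n * ln (real n)) \<longrightarrow>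
    (Corr_le n (P n) (D n) snr)\<^sup>2 \<le> 2 * q n"
proof -
  \<comment> \<open>The term 2 C / \<phi> is the growth of the 2/\<phi>-th power of n to the C; the
    extra 1 absorbs the constant \<open>b\<close> once n exceeds it.\<close>
  define C\<^sub>3 where "C\<^sub>3 = 1 + 2 * C / \<phi>"
  define b where "b = (C\<^sub>\<phi> * K)\<^sup>2 * 4 powr (2 / \<phi>)"
  have C\<^sub>3: "C\<^sub>3 \<ge> 0" using C \<phi> by (simp add: C\<^sub>3_def)
  have big: "filterlim (\<lambda>n. real n) at_top sequentially" by (rule filterlim_real_sequentially)
  have lnbig: "filterlim (\<lambda>n. ln (real n)) at_top sequentially"
    by (rule filterlim_compose[OF ln_at_top big])
  have ev: "\<forall>\<^sub>F n in sequentially. n \<ge> 10 \<and> ln (real n) \<ge> 16 \<and> ln (real n) \<ge> 8 + 4 * C\<^sub>3 + 4 * C\<^sub>1 \<and> real n \<ge> b"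
    using eventually_ge_at_top[of "10 :: nat"] lnbig big
    unfolding filterlim_at_top by (auto intro!: eventually_conj)
  show ?thesis
  proof (rule eventually_mono[OF ev], intro allI impI)
    fix n snr
    assume n: "n \<ge> 10 \<and> ln (real n) \<ge> 16 \<and> ln (real n) \<ge> 8 + 4 * C\<^sub>3 + 4 * C\<^sub>1 \<and> real n \<ge> b"
      and snr: "0 \<le> snr" "snr \<le> 1 / (q n * ln (real n))"
    have n0: "real n > 0" "n \<ge> 1" "n \<ge> 2" using n by auto
    have "(C\<^sub>\<phi> * K)\<^sup>2 * (4 * real n powr C) powr (2 / \<phi>) = b * real n powr (2 * C / \<phi>)"
      by (simp add: b_def powr_mult powr_powr mult.commute)
    also have "\<dots> \<le> real n * real n powr (2 * C / \<phi>)" using n by (intro mult_right_mono) auto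
    also have "\<dots> = real n powr C\<^sub>3" using n0 by (simp add: C\<^sub>3_def powr_add)
    finally have "(C\<^sub>\<phi> * K)\<^sup>2 * (4 * real n powr C) powr (2 / \<phi>) \<le> real n powr C\<^sub>3" .
    then show "(Corr_le n (P n) (D n) snr)\<^sup>2 \<le> 2 * q n"
      unfolding q_def
      by (intro Corr_le_twice_quantile[where C = C and C\<^sub>3 = C\<^sub>3 and C\<^sub>1 = C\<^sub>1 and \<phi> = \<phi> and K = K and C\<^sub>\<phi> = C\<^sub>\<phi>])
         (use n n0 C\<^sub>3 D[of n] \<kappa>[of n] \<phi> C\<^sub>1 weibull[of n] q[of n] snr in \<open>auto simp: q_def\<close>)
  qed
qed

text \<open>The linear part of the potential has difference quotient -u for every step, which the
  added u cancels. The closed form of the potential requires positive mass at both ends of the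
  step.\<close>

lemma discrete_deriv_FP_ann:
  assumes "q \<in> S_ov n P" "a q > 0" "q + a q \<in> S_ov n P"
  shows "u + discrete_deriv a (FP_ann n P u) q = - discrete_deriv a (\<lambda>t. ln (pmf (overlap_pmf n P) t)) q"
  using assms by (simp add: discrete_deriv_def FP_ann_eq field_simps)

text \<open>Asymptotic equivalence does not say on which side of D (log n)^2 the level D' lies;
  \<open>D'_ge\<close> does, and monotonicity of the quantile then passes from one level to the
  other. By \<open>quantile_in_S_ov\<close> the discrete derivative is taken at a point of positive
  mass. The hypotheses with a logarithm start at n = 2, as the level D (log n)^2 is 0 at n =
  1.\<close>

theorem theorem2p11:
  fixes C \<phi> K C\<^sub>\<phi> C\<^sub>1 :: real
    and D D' :: "nat \<Rightarrow> nat"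
    and A :: "nat \<Rightarrow> real"
    and P :: "nat \<Rightarrow> (nat \<Rightarrow> real) pmf"
    and a :: "nat \<Rightarrow> real \<Rightarrow> real"
  assumes C: "C > 0"
    and D: "\<And>n. n \<ge> 1 \<Longrightarrow> D n > 0 \<and> real (D n) \<le> real n powr C"
    and A: "\<And>n. n \<ge> 1 \<Longrightarrow> A n > 0"
    and prior: "\<And>n. n \<ge> 1 \<Longrightarrow> prior_on n (P n)"
    and a: "\<And>n q. n \<ge> 1 \<Longrightarrow> q \<in> S_ov n (P n) \<Longrightarrow> a n q > 0 \<and> q + a n q \<in> S_ov n (P n)"
    and quantile_in_S_ov:
      "\<And>n. n \<ge> 2 \<Longrightarrow> overlap_quantile n (P n) (real (D n)) \<in> S_ov n (P n)"
    and cumulants: "\<And>n \<alpha>. n \<ge> 1 \<Longrightarrow> \<alpha> \<in> multi_indices n (D n) \<Longrightarrow> cumulant n (P n) \<alpha> \<ge> 0"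
    and \<phi>: "\<phi> > 0" "K > 0" "C\<^sub>\<phi> > 0"
    and weibull: "\<And>n i. n \<ge> 1 \<Longrightarrow> i < n \<Longrightarrow>
      sub_weibull (measure_pmf (P n)) (\<lambda>x. x i) \<phi> K C\<^sub>\<phi>"
    and C\<^sub>1: "C\<^sub>1 > 0"
    and quantile_lower: "\<And>n. n \<ge> 2 \<Longrightarrow>
      overlap_quantile n (P n) (real (D n) * (ln (real n))\<^sup>2)
        \<ge> max (ln (real n) powr (- real (D n) / 2)) (real n powr (- C\<^sub>1))"
    and log_deriv: "\<And>n. n \<ge> 2 \<Longrightarrow>
      discrete_deriv (a n) (\<lambda>t. ln (pmf (overlap_pmf n (P n)) t))
          (overlap_quantile n (P n) (real (D n)))
        \<ge> - (A n / (overlap_quantile n (P n) (real (D n) * (ln (real n))\<^sup>2) * ln (real n)))"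
    and D'_pos: "\<And>n. n \<ge> 1 \<Longrightarrow> D' n > 0"
    and D'_asymp: "(\<lambda>n. real (D' n)) \<sim>[sequentially] (\<lambda>n. real (D n) * (ln (real n))\<^sup>2)"
    and D'_ge: "\<forall>\<^sub>F n in sequentially. real (D' n) \<ge> real (D n) * (ln (real n))\<^sup>2"
  shows "(\<forall>\<^sub>F n in sequentially. \<forall>u>0.
            u + discrete_deriv (a n) (FP_ann n (P n) u) (overlap_quantile n (P n) (real (D n))) > 0
            \<longrightarrow>
            (Corr_le n (P n) (D n)
               (1 / A n * (u + discrete_deriv (a n) (FP_ann n (P n) u)
                                 (overlap_quantile n (P n) (real (D n))))))\<^sup>2
              \<le> 2 * overlap_quantile n (P n) (real (D' n)))
       \<and> (\<forall>snr :: nat \<Rightarrow> real. (\<forall>n\<ge>1. snr n > 0) \<longrightarrow>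
            (\<forall>\<^sub>F n in sequentially.
               discrete_deriv (a n) (FP_ann n (P n) (snr n)) (overlap_quantile n (P n) (real (D n))) \<ge> 0
               \<longrightarrow>
               (Corr_le n (P n) (D n) (1 / A n * snr n))\<^sup>2
                 \<le> 2 * overlap_quantile n (P n) (real (D' n))))"
proof -
  let ?q = "\<lambda>n. overlap_quantile n (P n) (real (D n))"
  let ?Q = "\<lambda>n. overlap_quantile n (P n) (real (D n) * (ln (real n))\<^sup>2)"
  let ?\<Delta> = "\<lambda>n. discrete_deriv (a n) (\<lambda>t. ln (pmf (overlap_pmf n (P n)) t)) (?q n)"
  have Q: "?Q n \<ge> real n powr (- C\<^sub>1)" if "n \<ge> 2" for n using quantile_lower[OF that] by simp
  have \<Delta>: "u + discrete_deriv (a n) (FP_ann n (P n) u) (?q n) = - ?\<Delta> n" if "n \<ge> 2" for n u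
    using a[of n "?q n"] quantile_in_S_ov[OF that] that by (intro discrete_deriv_FP_ann) auto
  have ev: "\<forall>\<^sub>F n in sequentially. \<forall>v. 0 \<le> v \<longrightarrow> v \<le> 1 / (?Q n * ln (real n)) \<longrightarrow>
      (Corr_le n (P n) (D n) v)\<^sup>2 \<le> 2 * ?Q n"
    by (rule eventually_Corr_le_twice_quantile[OF C D cumulants \<phi>(1) C\<^sub>1 weibull Q]) auto
  \<comment> \<open>Both claims are instances: the first takes for \<open>v\<close> the value
    \<open>- ?\<Delta> n\<close> itself, the second takes \<open>snr n\<close>, which the sign of
    the derivative bounds by that value.\<close>
  have main: "\<forall>\<^sub>F n in sequentially. n \<ge> 2 \<and> (\<forall>v. 0 \<le> v \<longrightarrow> v \<le> - ?\<Delta> n \<longrightarrow>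
      (Corr_le n (P n) (D n) (1 / A n * v))\<^sup>2 \<le> 2 * overlap_quantile n (P n) (real (D' n)))"
    using ev D'_ge eventually_ge_at_top[of 2]
  proof eventually_elim
    case (elim n)
    have n: "n \<ge> 1" using elim by simp
    show ?case
    proof (intro conjI allI impI)
      fix v assume v: "0 \<le> v" "v \<le> - ?\<Delta> n"
      have "v \<le> A n / (?Q n * ln (real n))" using v(2) log_deriv[of n] elim by simp
      then have "1 / A n * v \<le> 1 / (?Q n * ln (real n))"
        using A[OF n] by (simp add: field_simps)
      moreover have "0 \<le> 1 / A n * v" using A[OF n] v by simp
      ultimately have "(Corr_le n (P n) (D n) (1 / A n * v))\<^sup>2 \<le> 2 * ?Q n"
        using elim(1) by blast
      also have "?Q n \<le> overlap_quantile n (P n) (real (D' n))"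
        using elim D[OF n] by (intro overlap_quantile_mono) auto
      finally show "(Corr_le n (P n) (D n) (1 / A n * v))\<^sup>2 \<le> 2 * overlap_quantile n (P n) (real (D' n))"
        by simp
    qed (use elim in simp)
  qed
  show ?thesis
  proof (intro conjI allI impI)
    show "\<forall>\<^sub>F n in sequentially. \<forall>u>0.
        u + discrete_deriv (a n) (FP_ann n (P n) u) (?q n) > 0 \<longrightarrow>
        (Corr_le n (P n) (D n) (1 / A n * (u + discrete_deriv (a n) (FP_ann n (P n) u) (?q n))))\<^sup>2
          \<le> 2 * overlap_quantile n (P n) (real (D' n))"
      using main
    proof eventually_elim
      case (elim n)
      then have n: "n \<ge> 2" by simp
      show ?case
        unfolding \<Delta>[OF n] using elim less_imp_le order_refl by blast
    qed
  next
    fix snr :: "nat \<Rightarrow> real" assume snr: "\<forall>n\<ge>1. snr n > 0"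
    show "\<forall>\<^sub>F n in sequentially.
        discrete_deriv (a n) (FP_ann n (P n) (snr n)) (?q n) \<ge> 0 \<longrightarrow>
        (Corr_le n (P n) (D n) (1 / A n * snr n))\<^sup>2 \<le> 2 * overlap_quantile n (P n) (real (D' n))"
      using main
    proof eventually_elim
      case (elim n)
      show ?case
      proof
        assume "discrete_deriv (a n) (FP_ann n (P n) (snr n)) (?q n) \<ge> 0"
        then have "snr n \<le> - ?\<Delta> n" using \<Delta>[of n "snr n"] elim by simp
        moreover have "0 \<le> snr n" using snr elim by (simp add: less_imp_le)
        ultimately show "(Corr_le n (P n) (D n) (1 / A n * snr n))\<^sup>2 \<le> 2 * overlap_quantile n (P n) (real (D' n))"
          using elim by blast
      qed
    qed
  qed
qed

end
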